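(* For each $n\ge1$ consider $n+1$ independent continuous time random walks $X_1(t),\dots,X_{n+1}(t)$ which begin at the integer locations $x_1<x_2<\cdots<x_{n+1}$ at time $t=0$. For given integers $y_1<y_2<\dots<y_{n+1}$ and $T>0$, let $\mathbb{P}_{n+1}(x_1,\dots,x_{n+1};y_1,\dots,y_{n+1};T)$ be the probability that $X_j(T)=y_j$ for $j=1,\dots,n+1$ and that $X_1(t),\dots,X_{n+1}(t)$ do not intersect for $0\le t\le T$. Suppose that $x_j=j$ for $1\le j\le n+1$, $y_k=k$ for $1\le k\le n$, while $y_{n+1}>n$ is arbitrary. If $T$ and $\beta_1:=y_{n+1}-n$ are bounded as $n\to\infty$, then as $n\to\infty$ $$\mathbb{P}_{n+1}(x_1,\dots,x_{n+1};y_1,\dots,y_{n+1};T)=\frac{e^{-(n+1)T}\left(\frac{T}{2}\right)^{\beta_1-1}e^{\frac{T^2}{4}}}{(\beta_1-1)!}\left(1+O(e^{-cn})\right),$$ where $c>0$ is any positive number.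
   Context: A continuous time random walk started at $x\in\mathbb{Z}$ is the process $X(t)=x+N_1(t)-N_2(t)$, $t\ge 0$, where $N_1,N_2$ are independent Poisson processes of rate $\lambda=1/2$. The walks do not intersect for $0\le t\le T$ if $X_i(t)\neq X_j(t)$ for all $i\ne j$ and all $t\in[0,T]$. *)

theory Defs
  imports "HOL-Probability.Probability" "HOL-Library.Landau_Symbols"
begin

definition sample_path :: "(real \<Rightarrow> 'a \<Rightarrow> 'b) \<Rightarrow> 'a \<Rightarrow> real \<Rightarrow> 'b" where
  "sample_path X \<omega> = (\<lambda>t\<in>{0..}. X t \<omega>)"

abbreviation path_space :: "(real \<Rightarrow> 'b) measure" where
  "path_space \<equiv> PiM {0..} (\<lambda>_. count_space UNIV)"

text \<open>
  The path properties are required at every sample point, not just almost surely.  Then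
  events such as "two walks meet at some time in \<open>[0, T]\<close>" depend only on countably many
  times and are measurable even if the probability space is not complete.
\<close>

definition poisson_process :: "'a measure \<Rightarrow> real \<Rightarrow> (real \<Rightarrow> 'a \<Rightarrow> nat) \<Rightarrow> bool" where
  "poisson_process M rate N \<longleftrightarrow>
     prob_space M \<and> rate > 0 \<and>
     (\<forall>t\<ge>0. N t \<in> measurable M (count_space UNIV)) \<and>
     (\<forall>\<omega>\<in>space M. N 0 \<omega> = 0 \<and> mono_on {0..} (\<lambda>t. N t \<omega>) \<and>
        (\<forall>t\<ge>0. continuous (at_right t) (\<lambda>s. N s \<omega>))) \<and>
     (\<forall>k ts. 0 \<le> ts 0 \<and> (\<forall>i<k. ts i < ts (Suc i)) \<longrightarrow>
        prob_space.indep_vars M (\<lambda>_. count_space UNIV)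
          (\<lambda>i \<omega>. N (ts (Suc i)) \<omega> - N (ts i) \<omega>) {..<k}) \<and>
     (\<forall>s t. 0 \<le> s \<and> s < t \<longrightarrow>
        distr M (count_space UNIV) (\<lambda>\<omega>. N t \<omega> - N s \<omega>) =
          measure_pmf (poisson_pmf (rate * (t - s))))"

definition random_walk :: "'a measure \<Rightarrow> int \<Rightarrow> (real \<Rightarrow> 'a \<Rightarrow> int) \<Rightarrow> bool" where
  "random_walk M x X \<longleftrightarrow>
     (\<exists>N\<^sub>1 N\<^sub>2. poisson_process M (1/2) N\<^sub>1 \<and> poisson_process M (1/2) N\<^sub>2 \<and>
        prob_space.indep_var M path_space (sample_path N\<^sub>1) path_space (sample_path N\<^sub>2) \<and>
        (\<forall>t\<ge>0. \<forall>\<omega>\<in>space M. X t \<omega> = x + int (N\<^sub>1 t \<omega>) - int (N\<^sub>2 t \<omega>)))"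

definition independent_random_walks ::
    "'a measure \<Rightarrow> nat \<Rightarrow> (nat \<Rightarrow> int) \<Rightarrow> (nat \<Rightarrow> real \<Rightarrow> 'a \<Rightarrow> int) \<Rightarrow> bool" where
  "independent_random_walks M m x X \<longleftrightarrow>
     prob_space M \<and>
     (\<forall>j\<in>{1..m}. random_walk M (x j) (X j)) \<and>
     prob_space.indep_vars M (\<lambda>_. path_space) (\<lambda>j. sample_path (X j)) {1..m}"

definition nonintersecting_on ::
    "nat \<Rightarrow> (nat \<Rightarrow> real \<Rightarrow> 'a \<Rightarrow> int) \<Rightarrow> real \<Rightarrow> 'a \<Rightarrow> bool" where
  "nonintersecting_on m X T \<omega> \<longleftrightarrow>
     (\<forall>i\<in>{1..m}. \<forall>j\<in>{1..m}. i \<noteq> j \<longrightarrow> (\<forall>t\<in>{0..T}. X i t \<omega> \<noteq> X j t \<omega>))"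

text \<open>
  The starting points are not an argument here, since they are determined by the walks
  \<open>X\<close>.
\<close>

definition nonintersection_prob ::
    "'a measure \<Rightarrow> nat \<Rightarrow> (nat \<Rightarrow> real \<Rightarrow> 'a \<Rightarrow> int) \<Rightarrow> (nat \<Rightarrow> int) \<Rightarrow> real \<Rightarrow> real" where
  "nonintersection_prob M m X y T =
     measure M {\<omega>\<in>space M. (\<forall>j\<in>{1..m}. X j T \<omega> = y j) \<and> nonintersecting_on m X T \<omega>}"

end

theory Submission
  imports Defs
begin

text \<open>The walks are given only by the laws of their increments and right-continuity, with no
  jump chain to condition on; a grid turns the path event into finitely many increments. With h =
  T/K, two jumps in one cell, of one walk or of two, cost O(h^2), and there are K cells. A walk
  jumps at total rate 1, which gives exp(-dT); each of the 2d possible jumps has rate 1/2, which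
  gives (T/2)^m / m!. One-cell probabilities are known only up to a factor exp(h^2/4) per walk, but
  its product over all walks and cells tends to 1. U and D commute on the whole chamber, where
  nothing stops the lowest particle from going down. The Heisenberg defect appears because raising
  starts from the packed configuration and so never reaches \<open>z 1 < 1\<close>. Subtracting j
  from \<open>z j\<close> gives a partition with at most d parts. With fewer than d cells it has an
  empty part, so \<open>z 1 = 1\<close>; this is the origin of the restriction l + k \<le> d. Beyond
  it the count can only fall short, and factorial decay of the exponential series allows every rate
  c.\<close>

text \<open>
  Cut \<open>[0, T]\<close> into \<open>K\<close> cells. Up to an event of probability \<open>O(1/K)\<close>, at most one jump occurs in
  each cell, and then the walks do not intersect iff their positions at the grid times form a path in
  the chamber \<open>z 1 < \<dots> < z d\<close>. Letting \<open>K \<rightarrow> \<infinity>\<close> turns the probability into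
  \<open>exp (- d T) \<Sum>\<^sub>m (T/2)\<^sup>m a\<^sub>m / m!\<close>, where \<open>a\<^sub>m\<close> counts the \<open>m\<close>-step walks in the chamber.
  The raising operator \<open>U\<close> and the lowering operator \<open>D\<close> on the chamber commute, so that
  \<open>a\<^sub>m = (m choose l) D\<^sup>l U\<^sup>l\<^sup>+\<^sup>k \<delta>\<close> with \<open>m = 2l + k\<close>, \<open>k = \<beta>\<^sub>1 - 1\<close>, and a relation of Heisenberg type
  gives \<open>D\<^sup>l U\<^sup>l\<^sup>+\<^sup>k \<delta> \<le> (l + k)!/k!\<close> at the end point, with equality as long as \<open>l + k \<le> d\<close>. Without the last
  restriction the series would sum to \<open>(T/2)\<^sup>k exp (T\<^sup>2/4) / k!\<close>, so the relative error is bounded by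
  a tail of the exponential series beyond index \<open>n - O(1)\<close>.
\<close>

section \<open>Raising and lowering operators on the chamber\<close>

definition chamber :: "nat \<Rightarrow> (nat \<Rightarrow> int) \<Rightarrow> bool" where
  "chamber d z \<longleftrightarrow> (\<forall>j\<in>{1..<d}. z j < z (Suc j))"

text \<open>The value at \<open>z\<close> collects the predecessors of \<open>z\<close>, so powers
  applied to a point mass count paths that end at \<open>z\<close>. Only \<open>z\<close> is tested;
  functions that vanish outside the chamber are thus the natural arguments, and all values are of
  this kind.\<close>

definition up_op :: "nat \<Rightarrow> ((nat \<Rightarrow> int) \<Rightarrow> real) \<Rightarrow> (nat \<Rightarrow> int) \<Rightarrow> real" where
  "up_op d f z = (if chamber d z then \<Sum>j\<in>{1..d}. f (z(j := z j - 1)) else 0)"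

definition down_op :: "nat \<Rightarrow> ((nat \<Rightarrow> int) \<Rightarrow> real) \<Rightarrow> (nat \<Rightarrow> int) \<Rightarrow> real" where
  "down_op d f z = (if chamber d z then \<Sum>j\<in>{1..d}. f (z(j := z j + 1)) else 0)"

lemma chamber_less:
  assumes "chamber d z" "1 \<le> i" "i < j" "j \<le> d"
  shows "z i < z j"
  using assms(3,4)
proof (induction j)
  case (Suc j)
  have s: "z j < z (Suc j)" using assms(1,2) Suc.prems by (auto simp: chamber_def)
  show ?case
  proof (cases "i = j")
    case False
    then have "z i < z j" using Suc by auto
    then show ?thesis using s by simp
  qed (use s in simp)
qed simp

lemma chamber_ge:
  assumes "chamber d z" "1 \<le> z 1" "1 \<le> j" "j \<le> d"
  shows "int j \<le> z j"
  using assms(3,4)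
proof (induction j)
  case (Suc j)
  show ?case
  proof (cases "j = 0")
    case False
    then have "z j < z (Suc j)" using assms(1) Suc.prems by (auto simp: chamber_def)
    then show ?thesis using Suc False by auto
  qed (use assms in simp)
qed simp

lemma chamber_lower_iff:
  assumes "chamber d z" "j \<in> {1..d}"
  shows "chamber d (z(j := z j - 1)) \<longleftrightarrow> j = 1 \<or> z (j - 1) + 1 < z j"
proof
  assume c: "chamber d (z(j := z j - 1))"
  show "j = 1 \<or> z (j - 1) + 1 < z j"
  proof (cases "j = 1")
    case False
    then have "j - 1 \<in> {1..<d}" using assms by auto
    from bspec[OF c[unfolded chamber_def] this] show ?thesis
      using False assms by (auto split: if_splits)
  qed simp
next
  assume "j = 1 \<or> z (j - 1) + 1 < z j"
  with assms show "chamber d (z(j := z j - 1))"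
    unfolding chamber_def by (auto simp: le_Suc_eq)
qed

lemma chamber_raise_iff:
  assumes "chamber d z" "j \<in> {1..d}"
  shows "chamber d (z(j := z j + 1)) \<longleftrightarrow> j = d \<or> z j + 1 < z (Suc j)"
proof
  assume c: "chamber d (z(j := z j + 1))"
  show "j = d \<or> z j + 1 < z (Suc j)"
  proof (cases "j = d")
    case False
    then have "j \<in> {1..<d}" using assms by auto
    from bspec[OF c[unfolded chamber_def] this] show ?thesis using False assms by auto
  qed simp
next
  assume "j = d \<or> z j + 1 < z (Suc j)"
  with assms show "chamber d (z(j := z j + 1))"
    unfolding chamber_def by fastforce
qed

text \<open>A gap larger than one lets its upper particle go down and its lower particle go up.
  Besides these, the first particle can always be lowered and the last one always raised, so both
  counts are one plus the number of such gaps.\<close>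

lemma card_lower_eq_card_raise:
  assumes "chamber d z"
  shows "card {j\<in>{1..d}. chamber d (z(j := z j - 1))} = card {j\<in>{1..d}. chamber d (z(j := z j + 1))}"
proof (cases "d = 0")
  case False
  let ?G = "{j\<in>{1..<d}. z j + 1 < z (Suc j)}"
  have "{j\<in>{1..d}. chamber d (z(j := z j - 1))} = {j\<in>{1..d}. j = 1 \<or> z (j - 1) + 1 < z j}"
    using chamber_lower_iff[OF assms] by blast
  also have "\<dots> = insert 1 (Suc ` ?G)"
  proof (intro set_eqI iffI)
    fix j assume j: "j \<in> {j\<in>{1..d}. j = 1 \<or> z (j - 1) + 1 < z j}"
    show "j \<in> insert 1 (Suc ` ?G)"
    proof (cases "j = 1")
      case False
      then have "j - 1 \<in> ?G" "j = Suc (j - 1)" using j by auto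
      then show ?thesis by blast
    qed simp
  qed (use False in auto)
  also have "card \<dots> = Suc (card ?G)"
    by (subst card_insert_disjoint) (auto simp: card_image)
  finally have 1: "card {j\<in>{1..d}. chamber d (z(j := z j - 1))} = Suc (card ?G)" .
  have "{j\<in>{1..d}. chamber d (z(j := z j + 1))} = {j\<in>{1..d}. j = d \<or> z j + 1 < z (Suc j)}"
    using chamber_raise_iff[OF assms] by blast
  also have "\<dots> = insert d ?G"
    using False by auto
  also have "card \<dots> = Suc (card ?G)"
    by (subst card_insert_disjoint) auto
  finally show ?thesis using 1 by simp
qed simp

lemma chamber_of_exchange:
  assumes z: "chamber d z" and ij: "i \<in> {1..d}" "j \<in> {1..d}" "i \<noteq> j"
    and e: "chamber d (z(j := z j - 1, i := z i + 1))"
  shows "chamber d (z(j := z j - 1))" "chamber d (z(i := z i + 1))"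
proof -
  show "chamber d (z(j := z j - 1))"
    unfolding chamber_lower_iff[OF z ij(2)]
  proof (cases "j = 1")
    case False
    then have "j - 1 \<in> {1..<d}" using ij by auto
    from bspec[OF e[unfolded chamber_def] this] show "j = 1 \<or> z (j - 1) + 1 < z j"
      using False ij by (auto split: if_splits)
  qed simp
  show "chamber d (z(i := z i + 1))"
    unfolding chamber_raise_iff[OF z ij(1)]
  proof (cases "i = d")
    case False
    then have "i \<in> {1..<d}" using ij by auto
    from bspec[OF e[unfolded chamber_def] this] show "i = d \<or> z i + 1 < z (Suc i)"
      using False ij by (auto split: if_splits)
  qed simp
qed

lemma sum_plus_diagonal:
  fixes g :: "'b \<Rightarrow> 'b \<Rightarrow> real"
  assumes "finite A"
  shows "(\<Sum>j\<in>A. \<Sum>i\<in>A. g i j + (if i = j then if P j then c else 0 else 0))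
    = (\<Sum>j\<in>A. \<Sum>i\<in>A. g i j) + real (card {j\<in>A. P j}) * c"
proof -
  have "(\<Sum>j\<in>A. \<Sum>i\<in>A. g i j + (if i = j then if P j then c else 0 else 0))
      = (\<Sum>j\<in>A. (\<Sum>i\<in>A. g i j) + (if P j then c else 0))"
    using assms by (intro sum.cong) (simp_all add: sum.distrib)
  also have "(\<Sum>j\<in>A. if P j then c else 0) = real (card {j\<in>A. P j}) * c"
    using assms by (simp add: sum.inter_filter[symmetric])
  then have "(\<Sum>j\<in>A. (\<Sum>i\<in>A. g i j) + (if P j then c else 0))
      = (\<Sum>j\<in>A. \<Sum>i\<in>A. g i j) + real (card {j\<in>A. P j}) * c"
    by (simp add: sum.distrib)
  finally show ?thesis .
qed

text \<open>When two different particles move, both orders pass through the chamber or the end point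
  is outside it, where \<open>f\<close> vanishes. When the same particle moves back and forth, the
  result is \<open>f z\<close>, as often as there are particles free to move, and this number is the
  same in both orders.\<close>

lemma up_down_commute:
  assumes f: "\<And>z. \<not> chamber d z \<Longrightarrow> f z = 0"
  shows "up_op d (down_op d f) = down_op d (up_op d f)"
proof
  fix z
  show "up_op d (down_op d f) z = down_op d (up_op d f) z"
  proof (cases "chamber d z")
    case True
    let ?lo = "\<lambda>j. z(j := z j - 1)" and ?hi = "\<lambda>i. z(i := z i + 1)"
    let ?g = "\<lambda>i j. if i = j then 0 else f (z(j := z j - 1, i := z i + 1))"
    have lo: "(if chamber d (?lo j) then f ((?lo j)(i := ?lo j i + 1)) else 0)
        = ?g i j + (if i = j then if chamber d (?lo j) then f z else 0 else 0)"
      if "i \<in> {1..d}" "j \<in> {1..d}" for i j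
      using chamber_of_exchange(1)[OF True that] f[of "z(j := z j - 1, i := z i + 1)"] by auto
    have hi: "(if chamber d (?hi i) then f ((?hi i)(j := ?hi i j - 1)) else 0)
        = ?g i j + (if j = i then if chamber d (?hi i) then f z else 0 else 0)"
      if "i \<in> {1..d}" "j \<in> {1..d}" for i j
      using chamber_of_exchange(2)[OF True that] f[of "z(j := z j - 1, i := z i + 1)"]
      by (auto simp: fun_upd_twist; blast)
    have "up_op d (down_op d f) z =
        (\<Sum>j\<in>{1..d}. \<Sum>i\<in>{1..d}. if chamber d (?lo j) then f ((?lo j)(i := ?lo j i + 1)) else 0)"
      unfolding up_op_def down_op_def using True by (auto intro!: sum.cong)
    also have "\<dots> = (\<Sum>j\<in>{1..d}. \<Sum>i\<in>{1..d}. ?g i j + (if i = j then if chamber d (?lo j) then f z else 0 else 0))"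
      by (intro sum.cong refl lo)
    also have "\<dots> = (\<Sum>j\<in>{1..d}. \<Sum>i\<in>{1..d}. ?g i j) + real (card {j\<in>{1..d}. chamber d (?lo j)}) * f z"
      by (subst sum_plus_diagonal) auto
    also have "\<dots> = (\<Sum>i\<in>{1..d}. \<Sum>j\<in>{1..d}. ?g i j) + real (card {i\<in>{1..d}. chamber d (?hi i)}) * f z"
      using card_lower_eq_card_raise[OF True] sum.swap[of ?g "{1..d}" "{1..d}"] by simp
    also have "\<dots> = (\<Sum>i\<in>{1..d}. \<Sum>j\<in>{1..d}. ?g i j + (if j = i then if chamber d (?hi i) then f z else 0 else 0))"
      by (subst sum_plus_diagonal) auto
    also have "\<dots> = (\<Sum>i\<in>{1..d}. \<Sum>j\<in>{1..d}. if chamber d (?hi i) then f ((?hi i)(j := ?hi i j - 1)) else 0)"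
      by (intro sum.cong refl hi[symmetric])
    also have "\<dots> = down_op d (up_op d f) z"
      unfolding up_op_def down_op_def using True by (auto intro!: sum.cong)
    finally show ?thesis .
  qed (simp add: up_op_def down_op_def)
qed


section \<open>Paths from the packed configuration and the Heisenberg relation\<close>

definition packed :: "nat \<Rightarrow> nat \<Rightarrow> int" where
  "packed d = (\<lambda>j. if j \<in> {1..d} then int j else 0)"

text \<open>Whole functions are compared, including indices outside 1..d; for this reason
  \<open>packed\<close> has the fixed value 0 there.\<close>

definition delta :: "'b \<Rightarrow> 'b \<Rightarrow> real" where
  "delta x z = (if z = x then 1 else 0)"

text \<open>In terms of the partition with parts \<open>z j - int j\<close>, this is the number of
  standard Young tableaux of that shape with p cells.\<close>

definition up_paths :: "nat \<Rightarrow> nat \<Rightarrow> (nat \<Rightarrow> int) \<Rightarrow> real" where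
  "up_paths d p = (up_op d ^^ p) (delta (packed d))"

lemma up_paths_0: "up_paths d 0 = delta (packed d)"
  by (simp add: up_paths_def)

lemma up_paths_Suc: "up_paths d (Suc p) = up_op d (up_paths d p)"
  by (simp add: up_paths_def)

lemma chamber_packed: "chamber d (packed d)"
  by (auto simp: chamber_def packed_def)

lemma up_paths_outside: "\<not> chamber d z \<Longrightarrow> up_paths d p z = 0"
  using chamber_packed[of d] by (cases p) (auto simp: up_paths_0 up_paths_Suc up_op_def delta_def)

lemma up_paths_nonneg: "up_paths d p z \<ge> 0"
  by (induction p arbitrary: z)
    (auto simp: up_paths_0 up_paths_Suc up_op_def delta_def intro!: sum_nonneg)

lemma up_paths_support:
  assumes "up_paths d p z \<noteq> 0"
  shows "(\<forall>j\<in>{1..d}. int j \<le> z j) \<and> (\<Sum>j\<in>{1..d}. z j - int j) = int p"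
  using assms
proof (induction p arbitrary: z)
  case 0
  then have "z = packed d" by (auto simp: up_paths_0 delta_def split: if_splits)
  then show ?case by (auto simp: packed_def)
next
  case (Suc p)
  then obtain j where j: "j \<in> {1..d}" "up_paths d p (z(j := z j - 1)) \<noteq> 0"
    by (auto simp: up_paths_Suc up_op_def split: if_splits elim: sum.not_neutral_contains_not_neutral)
  let ?w = "z(j := z j - 1)"
  have w: "\<forall>i\<in>{1..d}. int i \<le> ?w i" "(\<Sum>i\<in>{1..d}. ?w i - int i) = int p"
    using Suc.IH[OF j(2)] by auto
  have "int i \<le> z i" if "i \<in> {1..d}" for i
    using w(1) that by (cases "i = j") force+
  moreover have "(\<Sum>i\<in>{1..d}. z i - int i) = (\<Sum>i\<in>{1..d}. (?w i - int i) + (if i = j then 1 else 0))"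
    by (intro sum.cong) auto
  then have "(\<Sum>i\<in>{1..d}. z i - int i) = int (Suc p)"
    unfolding sum.distrib w(2) using j(1) by simp
  ultimately show ?case by blast
qed

text \<open>If the lowest particle had moved, strict order would force every particle to have moved,
  which takes at least d raisings. In terms of partitions: fewer than d cells leave one of the d
  parts empty.\<close>

lemma up_paths_first:
  assumes "up_paths d p z \<noteq> 0" "d \<ge> 1" "p < d"
  shows "z 1 = 1"
proof (rule ccontr)
  assume "z 1 \<noteq> 1"
  have z: "chamber d z" using assms up_paths_outside by blast
  have s: "\<forall>j\<in>{1..d}. int j \<le> z j" "(\<Sum>j\<in>{1..d}. z j - int j) = int p"
    using up_paths_support[OF assms(1)] by auto
  have "chamber d (\<lambda>j. z j - 1)" using z by (auto simp: chamber_def)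
  moreover have "1 \<le> z 1 - 1" using bspec[OF s(1), of 1] \<open>z 1 \<noteq> 1\<close> \<open>d \<ge> 1\<close> by simp
  ultimately have "int j \<le> z j - 1" if "j \<in> {1..d}" for j
    using chamber_ge[of d "\<lambda>j. z j - 1" j] that by auto
  then have "(\<Sum>j\<in>{1..d}. 1) \<le> (\<Sum>j\<in>{1..d}. z j - int j)"
    by (intro sum_mono) force
  then show False using s(2) assms(3) by simp
qed

text \<open>
  Raising and lowering commute, except that the lowest particle of a packed bottom block cannot
  be lowered within the region \<open>1 \<le> z 1\<close>. This defect is the Heisenberg relation of Young's
  lattice, and it makes lowering act on \<^term>\<open>up_paths d\<close> as differentiation does on monomials.
\<close>

lemma down_up_paths:
  assumes "chamber d z" "1 \<le> z 1" "d \<ge> 1"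
  shows "down_op d (up_paths d p) z \<le> real p * up_paths d (p - 1) z"
    and "p \<le> d \<Longrightarrow> down_op d (up_paths d p) z = real p * up_paths d (p - 1) z"
proof -
  have "down_op d (up_paths d p) z \<le> real p * up_paths d (p - 1) z
     \<and> (p \<le> d \<longrightarrow> down_op d (up_paths d p) z = real p * up_paths d (p - 1) z)"
    using assms(1,2)
  proof (induction p arbitrary: z)
    case (0 z)
    have "z(j := z j + 1) \<noteq> packed d" if j: "j \<in> {1..d}" for j
    proof
      assume "z(j := z j + 1) = packed d"
      then have "z j + 1 = int j" using j by (metis fun_upd_same packed_def)
      then show False using chamber_ge[OF 0, of j] j by simp
    qed
    then have "down_op d (up_paths d 0) z = 0"
      by (auto simp: down_op_def up_paths_0 delta_def intro!: sum.neutral)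
    then show ?case by simp
  next
    case (Suc p z)
    let ?lo = "\<lambda>j. z(j := z j - 1)"
    \<comment> \<open>The extra term is the defect. If the first particle is lowered from 1 to 0,
      raising another one leaves it at 0, where \<open>up_paths\<close> vanishes; only raising it
      again contributes, and this restores \<open>z\<close>.\<close>
    let ?r = "\<lambda>j. real p * up_paths d (p - 1) (?lo j) + (if j = 1 then if z 1 = 1 then up_paths d p z else 0 else 0)"
    have step: "down_op d (up_paths d p) (?lo j) \<le> ?r j
      \<and> (p \<le> d \<longrightarrow> down_op d (up_paths d p) (?lo j) = ?r j)" if j: "j \<in> {1..d}" for j
    proof (cases "j = 1 \<and> z 1 = 1")
      case True
      have 0: "up_paths d p' w = 0" if "w 1 < 1" for w p'
        using up_paths_support[of d p' w] \<open>d \<ge> 1\<close> that by (force dest!: bspec[of _ _ 1])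
      have "chamber d (?lo j)"
        using chamber_lower_iff[OF Suc.prems(1) j] True by simp
      then have "down_op d (up_paths d p) (?lo j)
          = (\<Sum>i\<in>{1..d}. up_paths d p ((?lo j)(i := ?lo j i + 1)))"
        by (simp add: down_op_def)
      also have "\<dots> = (\<Sum>i\<in>{1..d}. if i = 1 then up_paths d p z else 0)"
        by (rule sum.cong) (use True in \<open>auto intro!: 0 simp: fun_upd_idem\<close>)
      also have "\<dots> = up_paths d p z" using \<open>d \<ge> 1\<close> by simp
      finally show ?thesis using True 0[of "?lo j"] by simp
    next
      case False
      show ?thesis
      proof (cases "chamber d (?lo j)")
        case True
        have "1 \<le> ?lo j 1" using False Suc.prems(2) by auto
        note Suc.IH[OF True this]
        moreover have "?r j = real p * up_paths d (p - 1) (?lo j)" using False by auto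
        ultimately show ?thesis by presburger
      next
        case c: False
        then show ?thesis using False by (auto simp: down_op_def up_paths_outside)
      qed
    qed
    have "down_op d (up_paths d (Suc p)) = up_op d (down_op d (up_paths d p))"
      using up_down_commute[of d "up_paths d p"] by (simp add: up_paths_Suc up_paths_outside)
    then have "down_op d (up_paths d (Suc p)) z = (\<Sum>j\<in>{1..d}. down_op d (up_paths d p) (?lo j))"
      using Suc.prems by (simp add: up_op_def[of d "down_op d (up_paths d p)"])
    moreover have "(\<Sum>j\<in>{1..d}. ?r j) = real p * up_paths d p z + (if z 1 = 1 then up_paths d p z else 0)"
    proof -
      have "real p * (\<Sum>j\<in>{1..d}. up_paths d (p - 1) (?lo j)) = real p * up_paths d p z"
      \<comment> \<open>For p = 0 the truncated index p - 1 does no harm, since it comes with the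
        coefficient 0.\<close>
      proof (cases p)
        case (Suc q)
        then show ?thesis using Suc.prems by (simp add: up_paths_Suc up_op_def)
      qed simp
      then show ?thesis using \<open>d \<ge> 1\<close> by (simp add: sum.distrib sum_distrib_left[symmetric])
    qed
    moreover have "(\<Sum>j\<in>{1..d}. down_op d (up_paths d p) (?lo j)) \<le> (\<Sum>j\<in>{1..d}. ?r j)"
      by (intro sum_mono) (use step in blast)
    moreover have "(\<Sum>j\<in>{1..d}. down_op d (up_paths d p) (?lo j)) = (\<Sum>j\<in>{1..d}. ?r j)" if "p \<le> d"
      by (intro sum.cong) (use step that in blast)+
    \<comment> \<open>Here equality and inequality part: with p < d cells the first particle is
      still at 1, so the defect is present wherever \<open>up_paths d p\<close> is nonzero; in
      general it may be missing.\<close>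
    moreover have "(if z 1 = 1 then up_paths d p z else 0) = up_paths d p z" if "Suc p \<le> d"
      using up_paths_first[of d p z] that \<open>d \<ge> 1\<close> by auto
    moreover have "(if z 1 = 1 then up_paths d p z else 0) \<le> up_paths d p z"
      using up_paths_nonneg[of d p z] by simp
    moreover have "real (Suc p) * up_paths d (Suc p - 1) z = real p * up_paths d p z + up_paths d p z"
      by (simp add: algebra_simps)
    ultimately show ?case by (smt (verit) Suc_leD)
  qed
  then show "down_op d (up_paths d p) z \<le> real p * up_paths d (p - 1) z"
    and "p \<le> d \<Longrightarrow> down_op d (up_paths d p) z = real p * up_paths d (p - 1) z" by auto
qed

text \<open>Peeling off the outermost lowering evaluates the rest at raised configurations, which
  keep \<open>1 \<le> z 1\<close>. The induction hypothesis, used at k + 1, leaves a single lowering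
  of \<open>up_paths d (Suc k)\<close>, worth a factor k + 1.\<close>

lemma down_pow_up_paths:
  assumes "chamber d z" "1 \<le> z 1" "d \<ge> 1"
  shows "(down_op d ^^ i) (up_paths d (i + k)) z \<le> fact (i + k) / fact k * up_paths d k z"
    and "i + k \<le> d \<Longrightarrow> (down_op d ^^ i) (up_paths d (i + k)) z = fact (i + k) / fact k * up_paths d k z"
proof -
  have "(down_op d ^^ i) (up_paths d (i + k)) z \<le> fact (i + k) / fact k * up_paths d k z
    \<and> (i + k \<le> d \<longrightarrow> (down_op d ^^ i) (up_paths d (i + k)) z = fact (i + k) / fact k * up_paths d k z)"
    using assms(1,2)
  proof (induction i arbitrary: k z)
    case (Suc i k z)
    let ?hi = "\<lambda>j. z(j := z j + 1)"
    let ?c = "fact (i + Suc k) / fact (Suc k) :: real"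
    let ?g = "(down_op d ^^ i) (up_paths d (i + Suc k))"
    have step: "?g (?hi j) \<le> ?c * up_paths d (Suc k) (?hi j)
      \<and> (i + Suc k \<le> d \<longrightarrow> ?g (?hi j) = ?c * up_paths d (Suc k) (?hi j))" for j
    proof (cases "chamber d (?hi j)")
      case True
      moreover have "1 \<le> ?hi j 1" using Suc.prems by auto
      ultimately show ?thesis by (rule Suc.IH)
    next
      case False
      then have "?g (?hi j) = 0"
        by (cases i) (simp_all add: up_paths_outside, simp add: down_op_def)
      then show ?thesis using False by (simp add: up_paths_outside)
    qed
    have "(down_op d ^^ Suc i) (up_paths d (Suc i + k)) z = (\<Sum>j\<in>{1..d}. ?g (?hi j))"
      using Suc.prems by (simp add: down_op_def)
    moreover have "(\<Sum>j\<in>{1..d}. ?g (?hi j)) \<le> (\<Sum>j\<in>{1..d}. ?c * up_paths d (Suc k) (?hi j))"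
      by (intro sum_mono) (use step in blast)
    moreover have "(\<Sum>j\<in>{1..d}. ?g (?hi j)) = (\<Sum>j\<in>{1..d}. ?c * up_paths d (Suc k) (?hi j))"
      if "Suc i + k \<le> d"
      by (intro sum.cong refl mp[OF conjunct2[OF step]]) (use that in simp)
    moreover have "(\<Sum>j\<in>{1..d}. ?c * up_paths d (Suc k) (?hi j)) = ?c * down_op d (up_paths d (Suc k)) z"
      using Suc.prems by (simp add: down_op_def sum_distrib_left)
    moreover have "?c * down_op d (up_paths d (Suc k)) z \<le> ?c * (real (Suc k) * up_paths d k z)"
      using down_up_paths(1)[OF Suc.prems \<open>d \<ge> 1\<close>, of "Suc k"] by (intro mult_left_mono) auto
    moreover have "down_op d (up_paths d (Suc k)) z = real (Suc k) * up_paths d k z" if "Suc i + k \<le> d"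
      using down_up_paths(2)[OF Suc.prems \<open>d \<ge> 1\<close>, of "Suc k"] that by auto
    moreover have "?c * (real (Suc k) * up_paths d k z) = fact (Suc i + k) / fact k * up_paths d k z"
      by (simp add: fact_Suc[of k] del: of_nat_Suc)
    ultimately show ?case by auto
  qed simp
  then show "(down_op d ^^ i) (up_paths d (i + k)) z \<le> fact (i + k) / fact k * up_paths d k z"
    and "i + k \<le> d \<Longrightarrow> (down_op d ^^ i) (up_paths d (i + k)) z = fact (i + k) / fact k * up_paths d k z"
    by auto
qed

text \<open>There is exactly one path: the particles below d end where they started and can never
  come back down, so the last one makes all k steps. The partition has a single row.\<close>

lemma up_paths_last:
  assumes "d \<ge> 1"
  shows "up_paths d k ((packed d)(d := int d + int k)) = 1"
proof (induction k)
  case 0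
  have "(packed d)(d := int d) = packed d" using assms by (auto simp: packed_def)
  then show ?case by (simp add: up_paths_0 delta_def)
next
  case (Suc k)
  let ?y = "(packed d)(d := int d + int (Suc k))"
  have c: "chamber d ?y" by (auto simp: chamber_def packed_def)
  have "up_paths d (Suc k) ?y = (\<Sum>j\<in>{1..d}. up_paths d k (?y(j := ?y j - 1)))"
    using c by (simp add: up_paths_Suc up_op_def)
  also have "\<dots> = (\<Sum>j\<in>{1..d}. if j = d then 1 else 0)"
  proof (intro sum.cong refl)
    fix j assume j: "j \<in> {1..d}"
    show "up_paths d k (?y(j := ?y j - 1)) = (if j = d then 1 else 0)"
    proof (cases "j = d")
      case True
      then have "?y(j := ?y j - 1) = (packed d)(d := int d + int k)" by auto
      then show ?thesis using Suc True by (simp del: fun_upd_apply)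
    next
      case False
      then have "(?y(j := ?y j - 1)) j < int j" using j by (simp add: packed_def)
      then have "up_paths d k (?y(j := ?y j - 1)) = 0"
        using up_paths_support[of d k "?y(j := ?y j - 1)"] j by fastforce
      then show ?thesis using False by simp
    qed
  qed
  also have "\<dots> = 1" using assms by simp
  finally show ?case .
qed

section \<open>Counting walks in the chamber\<close>

definition walk_op :: "nat \<Rightarrow> ((nat \<Rightarrow> int) \<Rightarrow> real) \<Rightarrow> (nat \<Rightarrow> int) \<Rightarrow> real" where
  "walk_op d f z = up_op d f z + down_op d f z"

definition walks_from :: "nat \<Rightarrow> (nat \<Rightarrow> int) \<Rightarrow> nat \<Rightarrow> (nat \<Rightarrow> int) \<Rightarrow> real" where
  "walks_from d x m = (walk_op d ^^ m) (delta x)"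

lemma walks_from_0: "walks_from d x 0 = delta x"
  by (simp add: walks_from_def)

lemma walks_from_Suc: "walks_from d x (Suc m) = walk_op d (walks_from d x m)"
  by (simp add: walks_from_def)

lemma up_op_sum: "up_op d (\<lambda>z. \<Sum>i\<in>I. c i * f i z) z = (\<Sum>i\<in>I. c i * up_op d (f i) z)"
  unfolding up_op_def by (simp add: sum_distrib_left sum.swap[of _ I])

lemma down_op_sum: "down_op d (\<lambda>z. \<Sum>i\<in>I. c i * f i z) z = (\<Sum>i\<in>I. c i * down_op d (f i) z)"
  unfolding down_op_def by (simp add: sum_distrib_left sum.swap[of _ I])

lemma walk_op_sum: "walk_op d (\<lambda>z. \<Sum>i\<in>I. c i * f i z) z = (\<Sum>i\<in>I. c i * walk_op d (f i) z)"
  unfolding walk_op_def by (simp add: up_op_sum down_op_sum sum.distrib distrib_left)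

text \<open>Pascal's rule for a two-index array. It drives both the expansion of a power of U + D
  with commuting terms and the recursion of \<open>binomial_walks\<close>.\<close>

lemma binomial_sum_Suc:
  fixes F :: "nat \<Rightarrow> nat \<Rightarrow> real"
  shows "(\<Sum>i\<le>m. real (m choose i) * (F (Suc i) (m - i) + F i (Suc m - i)))
    = (\<Sum>i\<le>Suc m. real (Suc m choose i) * F i (Suc m - i))"
proof -
  have "(\<Sum>i\<le>Suc m. real (Suc m choose i) * F i (Suc m - i))
      = F 0 (Suc m) + (\<Sum>i\<le>m. real (Suc m choose Suc i) * F (Suc i) (m - i))"
    by (subst sum.atMost_Suc_shift) simp
  also have "\<dots> = F 0 (Suc m) + (\<Sum>i\<le>m. real (m choose Suc i) * F (Suc i) (m - i))
      + (\<Sum>i\<le>m. real (m choose i) * F (Suc i) (m - i))"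
    by (simp add: sum.distrib distrib_right)
  also have "F 0 (Suc m) + (\<Sum>i\<le>m. real (m choose Suc i) * F (Suc i) (m - i))
      = (\<Sum>i\<le>Suc m. real (m choose i) * F i (Suc m - i))"
    by (subst sum.atMost_Suc_shift) simp
  also have "\<dots> = (\<Sum>i\<le>m. real (m choose i) * F i (Suc m - i))"
    by simp
  finally show ?thesis by (simp add: sum.distrib distrib_left)
qed

lemma up_down_pow_outside: "\<not> chamber d z \<Longrightarrow> (down_op d ^^ i) (up_paths d p) z = 0"
  by (cases i) (simp_all add: up_paths_outside down_op_def)

lemma up_op_down_pow: "up_op d ((down_op d ^^ i) (up_paths d p)) = (down_op d ^^ i) (up_paths d (Suc p))"
proof (induction i)
  case (Suc i)
  show ?case
    using up_down_commute[of d "(down_op d ^^ i) (up_paths d p)"] Suc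
    by (simp add: up_down_pow_outside)
qed (simp add: up_paths_Suc)

text \<open>The binomial theorem for the commuting operators. All lowerings are placed outermost, so
  that they act on \<open>up_paths\<close>, where their effect is known.\<close>

lemma walks_from_packed_eq:
  "walks_from d (packed d) m z
    = (\<Sum>i\<le>m. real (m choose i) * (down_op d ^^ i) (up_paths d (m - i)) z)"
proof (induction m arbitrary: z)
  case (Suc m)
  have "walks_from d (packed d) m = (\<lambda>z. \<Sum>i\<le>m. real (m choose i) * (down_op d ^^ i) (up_paths d (m - i)) z)"
    using Suc by blast
  then have "walks_from d (packed d) (Suc m) z
      = (\<Sum>i\<le>m. real (m choose i) * walk_op d ((down_op d ^^ i) (up_paths d (m - i))) z)"
    by (simp add: walks_from_Suc walk_op_sum)
  also have "\<dots> = (\<Sum>i\<le>m. real (m choose i) * ((down_op d ^^ Suc i) (up_paths d (m - i)) z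
      + (down_op d ^^ i) (up_paths d (Suc m - i)) z))"
    by (intro sum.cong) (auto simp: walk_op_def up_op_down_pow Suc_diff_le)
  also have "\<dots> = (\<Sum>i\<le>Suc m. real (Suc m choose i) * (down_op d ^^ i) (up_paths d (Suc m - i)) z)"
    by (rule binomial_sum_Suc)
  finally show ?case .
qed (simp add: walks_from_0 up_paths_0)

lemma down_pow_up_paths_support:
  assumes "(down_op d ^^ i) (up_paths d p) z \<noteq> 0"
  shows "(\<Sum>j\<in>{1..d}. z j - int j) = int p - int i"
  using assms
proof (induction i arbitrary: z)
  case 0
  then show ?case using up_paths_support by simp
next
  case (Suc i)
  then obtain j where j: "j \<in> {1..d}" "(down_op d ^^ i) (up_paths d p) (z(j := z j + 1)) \<noteq> 0"
    by (auto simp: down_op_def[of d "(down_op d ^^ i) (up_paths d p)"] split: if_splits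
        elim: sum.not_neutral_contains_not_neutral)
  let ?w = "z(j := z j + 1)"
  have "(\<Sum>i\<in>{1..d}. z i - int i) = (\<Sum>i\<in>{1..d}. (?w i - int i) - (if i = j then 1 else 0))"
    by (intro sum.cong) auto
  then show ?case unfolding sum_subtractf Suc.IH[OF j(2), unfolded sum_subtractf]
    using j(1) Suc.IH[OF j(2)] by (simp add: sum_subtractf)
qed

text \<open>Raising adds a cell and lowering removes one, and \<open>y k\<close> has size k, so of
  the expansion only the term with m - i = i + k survives. The binomial coefficient times (l+k)!/k!
  is (2l+k)!/(l! k!); once divided by (2l+k)! it yields the terms of an exponential series in
  l.\<close>

lemma walks_from_packed_last:
  assumes "d \<ge> 1"
  defines "y \<equiv> \<lambda>k. (packed d)(d := int d + int k)"
  shows "m \<notin> range (\<lambda>l. 2 * l + k) \<Longrightarrow> walks_from d (packed d) m (y k) = 0"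
    and "walks_from d (packed d) (2 * l + k) (y k) \<le> fact (2 * l + k) / (fact l * fact k)"
    and "l + k \<le> d \<Longrightarrow> walks_from d (packed d) (2 * l + k) (y k) = fact (2 * l + k) / (fact l * fact k)"
proof -
  have s: "(\<Sum>j\<in>{1..d}. y k j - int j) = int k"
  proof -
    have "(\<Sum>j\<in>{1..d}. y k j - int j) = (\<Sum>j\<in>{1..d}. if j = d then int k else 0)"
      by (intro sum.cong) (auto simp: y_def packed_def)
    then show ?thesis using assms by simp
  qed
  have off: "(down_op d ^^ i) (up_paths d p) (y k) = 0" if "p \<noteq> i + k" for i p
    using down_pow_up_paths_support[of i d p "y k"] that unfolding s by linarith
  have c: "chamber d (y k)" by (auto simp: y_def chamber_def packed_def)
  have 1: "1 \<le> y k 1" using assms by (auto simp: y_def packed_def)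
  have v: "up_paths d k (y k) = 1" unfolding y_def by (rule up_paths_last[OF assms(1)])
  show "walks_from d (packed d) m (y k) = 0" if "m \<notin> range (\<lambda>l. 2 * l + k)"
  proof -
    have "m - i \<noteq> i + k" if "i \<le> m" for i
      using \<open>m \<notin> range (\<lambda>l. 2 * l + k)\<close> that by (auto simp: image_iff) presburger
    then show ?thesis unfolding walks_from_packed_eq using off by (intro sum.neutral) auto
  qed
  let ?D = "(down_op d ^^ l) (up_paths d (l + k)) (y k)"
  have "walks_from d (packed d) (2 * l + k) (y k)
      = (\<Sum>i\<le>2 * l + k. if i = l then real ((2 * l + k) choose l) * ?D else 0)"
    unfolding walks_from_packed_eq
  proof (intro sum.cong refl)
    fix i assume "i \<in> {..2 * l + k}"
    then show "real ((2 * l + k) choose i) * (down_op d ^^ i) (up_paths d (2 * l + k - i)) (y k)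
      = (if i = l then real ((2 * l + k) choose l) * ?D else 0)"
      using off[of "2 * l + k - i" i] by (auto simp: mult_2)
  qed
  then have e: "walks_from d (packed d) (2 * l + k) (y k) = real ((2 * l + k) choose l) * ?D"
    by simp
  have b: "real ((2 * l + k) choose l) = fact (2 * l + k) / (fact l * fact (l + k))"
    by (simp add: binomial_fact mult_2)
  have q: "real ((2 * l + k) choose l) * (fact (l + k) / fact k) = fact (2 * l + k) / (fact l * fact k)"
    unfolding b by simp
  show "walks_from d (packed d) (2 * l + k) (y k) \<le> fact (2 * l + k) / (fact l * fact k)"
    unfolding e q[symmetric] using down_pow_up_paths(1)[OF c 1 assms(1), of l k] v
    by (intro mult_left_mono) auto
  show "walks_from d (packed d) (2 * l + k) (y k) = fact (2 * l + k) / (fact l * fact k)" if "l + k \<le> d"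
    unfolding e q[symmetric] using down_pow_up_paths(2)[OF c 1 assms(1), of l k] v that by auto
qed

lemma walks_from_nonneg: "walks_from d x m z \<ge> 0"
  by (induction m arbitrary: z)
    (auto simp: walks_from_0 walks_from_Suc walk_op_def up_op_def down_op_def delta_def
      intro!: sum_nonneg add_nonneg_nonneg)

text \<open>A step has at most 2d choices. The crude bound serves as majorant when the limit is
  taken inside the series.\<close>

lemma walks_from_le: "walks_from d x m z \<le> (2 * real d) ^ m"
proof (induction m arbitrary: z)
  case (Suc m)
  have "up_op d (walks_from d x m) z \<le> real d * (2 * real d) ^ m"
    unfolding up_op_def using sum_bounded_above[of "{1..d}", OF Suc] by auto
  moreover have "down_op d (walks_from d x m) z \<le> real d * (2 * real d) ^ m"
    unfolding down_op_def using sum_bounded_above[of "{1..d}", OF Suc] by auto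
  ultimately show ?case by (simp add: walks_from_Suc walk_op_def)
qed (simp add: walks_from_0 delta_def)

section \<open>Discrete paths in the chamber\<close>

text \<open>\<open>z\<close> itself belongs to the set, because most cells contain no jump.
  Configurations in which two particles have moved are left out; such cells go into an exceptional
  event.\<close>

definition nbrs :: "nat \<Rightarrow> (nat \<Rightarrow> int) \<Rightarrow> (nat \<Rightarrow> int) set" where
  "nbrs d z = insert z ((\<lambda>j. z(j := z j - 1)) ` {1..d} \<union> (\<lambda>j. z(j := z j + 1)) ` {1..d})"

lemma finite_nbrs: "finite (nbrs d z)"
  by (simp add: nbrs_def)

lemma sum_nbrs:
  fixes g :: "(nat \<Rightarrow> int) \<Rightarrow> real"
  shows "sum g (nbrs d z) = g z + (\<Sum>j\<in>{1..d}. g (z(j := z j - 1))) + (\<Sum>j\<in>{1..d}. g (z(j := z j + 1)))"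
proof -
  let ?lo = "\<lambda>j. z(j := z j - 1)" and ?hi = "\<lambda>j. z(j := z j + 1)"
  have lo: "z i - 1 \<noteq> z i" and hi: "z i + 1 \<noteq> z i" for i by auto
  have 1: "inj_on ?lo {1..d}" "inj_on ?hi {1..d}"
    by (intro inj_onI; metis fun_upd_apply lo hi)+
  have 2: "?lo ` {1..d} \<inter> ?hi ` {1..d} = {}"
  proof -
    have "?lo i \<noteq> ?hi j" for i j
    proof
      assume "?lo i = ?hi j"
      then have "?lo i i = ?hi j i" by simp
      then show False by (simp split: if_splits)
    qed
    then show ?thesis by blast
  qed
  have 3: "z \<notin> ?lo ` {1..d} \<union> ?hi ` {1..d}"
    using fun_upd_same[of z] lo hi by (metis (no_types, lifting) UnE imageE)
  have "sum g (nbrs d z) = g z + (sum g (?lo ` {1..d}) + sum g (?hi ` {1..d}))"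
    unfolding nbrs_def by (subst sum.insert[OF _ 3]) (simp_all only: finite_Un finite_imageI
        finite_atLeastAtMost sum.union_disjoint[OF _ _ 2] simp_thms)
  then show ?thesis
    by (simp only: sum.reindex[OF 1(1)] sum.reindex[OF 1(2)] comp_def add.assoc)
qed

definition step_weight :: "(int \<Rightarrow> real) \<Rightarrow> nat \<Rightarrow> (nat \<Rightarrow> int) \<Rightarrow> real" where
  "step_weight q d e = (\<Prod>j\<in>{1..d}. q (e j))"

text \<open>Total weight of the k-cell paths from x to z, split by the last step. \<open>q\<close>
  plays the part of the law of one walk's increment over a cell.\<close>

fun path_weight :: "(int \<Rightarrow> real) \<Rightarrow> nat \<Rightarrow> (nat \<Rightarrow> int) \<Rightarrow> nat \<Rightarrow> (nat \<Rightarrow> int) \<Rightarrow> real" where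
  "path_weight q d x 0 z = delta x z"
| "path_weight q d x (Suc k) z = (if chamber d z
     then \<Sum>w\<in>nbrs d z. path_weight q d x k w * step_weight q d (\<lambda>j. z j - w j) else 0)"

text \<open>This is (1 + u W)^k applied to the point mass at x, with W the operator
  \<open>walk_op d\<close>: m of the k cells are chosen to carry a jump, and each jump has weight
  u.\<close>

definition binomial_walks :: "real \<Rightarrow> nat \<Rightarrow> (nat \<Rightarrow> int) \<Rightarrow> nat \<Rightarrow> (nat \<Rightarrow> int) \<Rightarrow> real" where
  "binomial_walks u d x k z = (\<Sum>m\<le>k. real (k choose m) * (u ^ m * walks_from d x m z))"

lemma binomial_walks_Suc:
  "binomial_walks u d x (Suc k) z
    = binomial_walks u d x k z + u * walk_op d (binomial_walks u d x k) z"
proof -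
  have "binomial_walks u d x (Suc k) z
      = (\<Sum>m\<le>k. real (k choose m) * (u ^ Suc m * walks_from d x (Suc m) z + u ^ m * walks_from d x m z))"
    unfolding binomial_walks_def
    by (rule binomial_sum_Suc[of _ "\<lambda>m _. u ^ m * walks_from d x m z", symmetric])
  also have "\<dots> = binomial_walks u d x k z
      + u * (\<Sum>m\<le>k. real (k choose m) * u ^ m * walk_op d (walks_from d x m) z)"
    by (simp add: binomial_walks_def sum.distrib distrib_left sum_distrib_left walks_from_Suc mult_ac)
  also have "(\<Sum>m\<le>k. real (k choose m) * u ^ m * walk_op d (walks_from d x m) z)
      = walk_op d (binomial_walks u d x k) z"
    unfolding walk_op_sum[symmetric] binomial_walks_def by (simp add: mult_ac)
  finally show ?thesis .
qed

lemma binomial_walks_nonneg: "u \<ge> 0 \<Longrightarrow> binomial_walks u d x k z \<ge> 0"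
  unfolding binomial_walks_def by (intro sum_nonneg mult_nonneg_nonneg walks_from_nonneg) auto

lemma binomial_walks_outside:
  assumes "chamber d x" "\<not> chamber d z"
  shows "binomial_walks u d x k z = 0"
proof -
  have "walks_from d x m z = 0" for m
    using assms
    by (cases m) (auto simp: walks_from_0 walks_from_Suc walk_op_def up_op_def down_op_def delta_def)
  then show ?thesis by (simp add: binomial_walks_def)
qed

lemma step_weight_single:
  assumes "i \<in> {1..d}"
  shows "step_weight q d (\<lambda>j. if j = i then s else 0) = q s * q 0 ^ (d - 1)"
proof -
  have "step_weight q d (\<lambda>j. if j = i then s else 0) = q s * (\<Prod>j\<in>{1..d} - {i}. q (if j = i then s else 0))"
    unfolding step_weight_def using assms by (subst prod.remove[of _ i]) auto
  also have "(\<Prod>j\<in>{1..d} - {i}. q (if j = i then s else 0)) = (\<Prod>j\<in>{1..d} - {i}. q 0)"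
    by (intro prod.cong) auto
  finally show ?thesis using assms by simp
qed

lemma step_weight_simps:
  "step_weight q d (\<lambda>j. z j - z j) = q 0 ^ d"
  "i \<in> {1..d} \<Longrightarrow> step_weight q d (\<lambda>j. z j - (z(i := z i - 1)) j) = q 1 * q 0 ^ (d - 1)"
  "i \<in> {1..d} \<Longrightarrow> step_weight q d (\<lambda>j. z j - (z(i := z i + 1)) j) = q (- 1) * q 0 ^ (d - 1)"
proof -
  have "(\<lambda>j. z j - (z(i := z i - 1)) j) = (\<lambda>j. if j = i then 1 else 0)"
    "(\<lambda>j. z j - (z(i := z i + 1)) j) = (\<lambda>j. if j = i then - 1 else 0)" by auto
  then show "i \<in> {1..d} \<Longrightarrow> step_weight q d (\<lambda>j. z j - (z(i := z i - 1)) j) = q 1 * q 0 ^ (d - 1)"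
    "i \<in> {1..d} \<Longrightarrow> step_weight q d (\<lambda>j. z j - (z(i := z i + 1)) j) = q (- 1) * q 0 ^ (d - 1)"
    by (simp_all only: step_weight_single)
qed (simp add: step_weight_def)

text \<open>A cell without jump weighs about e^d and a cell with a given jump about e^d u, in both
  cases within a factor between 1 and b^d. One step of the path recursion is therefore e^d (1 + u W)
  up to that factor. The intended values are e = exp(-h), u = h/2 and b = exp(h^2/4).\<close>

lemma path_weight_bounds:
  assumes q0: "e \<le> q 0" "q 0 \<le> e * b"
    and q1: "\<And>s. s \<in> {1, -1} \<Longrightarrow> e * u \<le> q s \<and> q s \<le> e * u * b"
    and pos: "e \<ge> 0" "b \<ge> 1" "u \<ge> 0" and x: "chamber d x"
  shows "(e ^ d) ^ k * binomial_walks u d x k z \<le> path_weight q d x k z"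
    and "path_weight q d x k z \<le> ((e * b) ^ d) ^ k * binomial_walks u d x k z"
proof -
  have w0: "e ^ d \<le> q 0 ^ d" "q 0 ^ d \<le> (e * b) ^ d"
    using q0 pos by (auto intro!: power_mono)
  have w1: "e ^ d * u \<le> q s * q 0 ^ (d - 1)" "q s * q 0 ^ (d - 1) \<le> (e * b) ^ d * u"
    if "s \<in> {1, -1}" "d \<ge> 1" for s
  proof -
    have d: "e ^ d * u = e * u * e ^ (d - 1)" "(e * b) ^ d * u = e * b * u * (e * b) ^ (d - 1)"
      using that by (cases d; simp)+
    have q: "e * u \<le> q s" "q s \<le> e * b * u" using q1[OF that(1)] by (auto simp: mult_ac)
    have "0 \<le> e * u" "0 \<le> q s" using q pos by (auto intro: order_trans[of 0 "e * u"])
    then show "e ^ d * u \<le> q s * q 0 ^ (d - 1)" "q s * q 0 ^ (d - 1) \<le> (e * b) ^ d * u"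
      unfolding d using q q0 pos by (intro mult_mono power_mono; simp)+
  qed
  let ?lo = "\<lambda>z j. z(j := z j - 1 :: int)" and ?hi = "\<lambda>z j. z(j := z j + 1 :: int)"
  have W: "path_weight q d x (Suc k) z = path_weight q d x k z * q 0 ^ d
     + (\<Sum>j\<in>{1..d}. path_weight q d x k (?lo z j) * (q 1 * q 0 ^ (d - 1)))
     + (\<Sum>j\<in>{1..d}. path_weight q d x k (?hi z j) * (q (- 1) * q 0 ^ (d - 1)))"
    if "chamber d z" for k z
  proof -
    have "(\<Sum>j\<in>{1..d}. path_weight q d x k (?lo z j) * step_weight q d (\<lambda>i. z i - ?lo z j i))
        = (\<Sum>j\<in>{1..d}. path_weight q d x k (?lo z j) * (q 1 * q 0 ^ (d - 1)))"
      by (intro sum.cong refl) (simp only: step_weight_simps(2))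
    moreover have "(\<Sum>j\<in>{1..d}. path_weight q d x k (?hi z j) * step_weight q d (\<lambda>i. z i - ?hi z j i))
        = (\<Sum>j\<in>{1..d}. path_weight q d x k (?hi z j) * (q (- 1) * q 0 ^ (d - 1)))"
      by (intro sum.cong refl) (simp only: step_weight_simps(3))
    ultimately show ?thesis
      unfolding path_weight.simps(2) sum_nbrs step_weight_simps(1) by (simp only: that if_True)
  qed
  have R: "binomial_walks u d x (Suc k) z = binomial_walks u d x k z
     + (\<Sum>j\<in>{1..d}. u * binomial_walks u d x k (?lo z j))
     + (\<Sum>j\<in>{1..d}. u * binomial_walks u d x k (?hi z j))" if "chamber d z" for k z
    unfolding binomial_walks_Suc walk_op_def up_op_def down_op_def
    using that by (simp add: sum_distrib_left distrib_left)
  have "(e ^ d) ^ k * binomial_walks u d x k z \<le> path_weight q d x k z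
    \<and> path_weight q d x k z \<le> ((e * b) ^ d) ^ k * binomial_walks u d x k z"
  proof (induction k arbitrary: z)
    case 0
    then show ?case by (simp add: binomial_walks_def walks_from_0)
  next
    case (Suc k)
    show ?case
    proof (cases "chamber d z")
      case False
      then show ?thesis by (simp add: binomial_walks_outside x del: power_Suc)
    next
      case True
      let ?R = "binomial_walks u d x k" and ?W = "path_weight q d x k"
      have l: "(e ^ d) ^ k * ?R z \<le> ?W z" and r: "?W z \<le> ((e * b) ^ d) ^ k * ?R z" for z
        using Suc by auto
      have lp: "0 \<le> (e ^ d) ^ k * ?R z" for z using pos by (simp add: binomial_walks_nonneg)
      have rp: "0 \<le> ((e * b) ^ d) ^ k * ?R z" for z using pos by (simp add: binomial_walks_nonneg)
      have lower: "(e ^ d) ^ k * ?R z * c \<le> ?W z * c'" if "c \<le> c'" "0 \<le> c" for z c c'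
        using l lp[of z] that by (intro mult_mono) (auto intro: order_trans)
      have upper: "?W z * c' \<le> ((e * b) ^ d) ^ k * ?R z * c" if "c' \<le> c" "0 \<le> c'" for z c c'
        using r rp[of z] that by (intro mult_mono) auto
      have wp: "0 \<le> e ^ d" "0 \<le> e ^ d * u" using pos by auto
      have "(e ^ d) ^ Suc k * binomial_walks u d x (Suc k) z = (e ^ d) ^ k * ?R z * e ^ d
          + (\<Sum>j\<in>{1..d}. (e ^ d) ^ k * ?R (?lo z j) * (e ^ d * u))
          + (\<Sum>j\<in>{1..d}. (e ^ d) ^ k * ?R (?hi z j) * (e ^ d * u))"
        unfolding R[OF True] by (simp add: distrib_left sum_distrib_left mult_ac)
      also have "\<dots> \<le> path_weight q d x (Suc k) z"
        unfolding W[OF True] using w0 wp w1 by (intro add_mono sum_mono lower) auto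
      finally have 1: "(e ^ d) ^ Suc k * binomial_walks u d x (Suc k) z \<le> path_weight q d x (Suc k) z" .
      have "path_weight q d x (Suc k) z \<le> ((e * b) ^ d) ^ k * ?R z * (e * b) ^ d
          + (\<Sum>j\<in>{1..d}. ((e * b) ^ d) ^ k * ?R (?lo z j) * ((e * b) ^ d * u))
          + (\<Sum>j\<in>{1..d}. ((e * b) ^ d) ^ k * ?R (?hi z j) * ((e * b) ^ d * u))"
        unfolding W[OF True] using w0 wp w1
        by (intro add_mono sum_mono upper) (auto intro: order_trans[OF wp(1)] order_trans[OF wp(2)])
      also have "\<dots> = ((e * b) ^ d) ^ Suc k * binomial_walks u d x (Suc k) z"
        unfolding R[OF True] by (simp add: distrib_left sum_distrib_left mult_ac)
      finally show ?thesis using 1 by blast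
    qed
  qed
  then show "(e ^ d) ^ k * binomial_walks u d x k z \<le> path_weight q d x k z"
    "path_weight q d x k z \<le> ((e * b) ^ d) ^ k * binomial_walks u d x k z" by auto
qed

text \<open>Neighbourhood is read from the later point to the earlier one, as in
  \<open>path_weight\<close>, so that the event decomposes over the predecessor of the end
  point.\<close>

definition grid_path :: "nat \<Rightarrow> (nat \<Rightarrow> nat \<Rightarrow> int) \<Rightarrow> nat \<Rightarrow> (nat \<Rightarrow> int) \<Rightarrow> bool" where
  "grid_path d p k z \<longleftrightarrow> p k = z \<and> (\<forall>i<k. chamber d (p (Suc i)) \<and> p i \<in> nbrs d (p (Suc i)))"

lemma grid_path_Suc:
  "grid_path d p (Suc k) z \<longleftrightarrow> chamber d z \<and> p (Suc k) = z \<and> (\<exists>w\<in>nbrs d z. grid_path d p k w)"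
  unfolding grid_path_def All_less_Suc by blast

text \<open>
  The induction turns prescribed increments into steps of an admissible path one cell at a time, so
  that the product formula for complete increment sequences suffices.
\<close>

lemma (in prob_space) prob_grid_path:
  fixes pos :: "nat \<Rightarrow> 'a \<Rightarrow> nat \<Rightarrow> int"
  assumes start: "\<And>\<omega>. \<omega> \<in> space M \<Longrightarrow> pos 0 \<omega> = x"
    and out: "\<And>i j \<omega>. \<omega> \<in> space M \<Longrightarrow> j \<notin> {1..d} \<Longrightarrow> pos i \<omega> j = x j"
    and meas: "\<And>i j. i \<le> K \<Longrightarrow> j \<in> {1..d} \<Longrightarrow> (\<lambda>\<omega>. pos i \<omega> j) \<in> measurable M (count_space UNIV)"
    and increments: "\<And>s. prob {\<omega>\<in>space M. \<forall>i<K. \<forall>j\<in>{1..d}. pos (Suc i) \<omega> j - pos i \<omega> j = s i j}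
      = (\<Prod>i<K. step_weight q d (s i))"
  shows "{\<omega>\<in>space M. grid_path d (\<lambda>i. pos i \<omega>) K z} \<in> events"
    and "prob {\<omega>\<in>space M. grid_path d (\<lambda>i. pos i \<omega>) K z} = path_weight q d x K z"
proof -
  \<comment> \<open>A hybrid event: the first k cells form an admissible path to z, the remaining
    ones have the increments prescribed by s. For k = 0 this is the assumed product formula, for k =
    K the claim.\<close>
  define S where "S k z s = {\<omega>\<in>space M. grid_path d (\<lambda>i. pos i \<omega>) k z
      \<and> (\<forall>i\<in>{k..<K}. \<forall>j\<in>{1..d}. pos (Suc i) \<omega> j - pos i \<omega> j = s i j)}" for k z s
  have "S k z s \<in> events \<and> prob (S k z s) = path_weight q d x k z * (\<Prod>i\<in>{k..<K}. step_weight q d (s i))"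
    if "k \<le> K" for k z s
    using that
  proof (induction k arbitrary: z s)
    case 0
    let ?I = "{\<omega>\<in>space M. \<forall>i<K. \<forall>j\<in>{1..d}. pos (Suc i) \<omega> j - pos i \<omega> j = s i j}"
    have eq: "S 0 z s = (if z = x then ?I else {})"
    proof -
      have "grid_path d (\<lambda>i. pos i \<omega>) 0 z \<longleftrightarrow> z = x" if "\<omega> \<in> space M" for \<omega>
        unfolding grid_path_def start[OF that] by blast
      then show ?thesis
        unfolding S_def atLeast0LessThan by (cases "z = x") (auto cong: conj_cong)
    qed
    have ev: "{\<omega>\<in>space M. pos (Suc i) \<omega> j - pos i \<omega> j = s i j} \<in> events" if "i < K" "j \<in> {1..d}" for i j
    proof -
      have [measurable]: "(\<lambda>\<omega>. pos (Suc i) \<omega> j) \<in> measurable M (count_space UNIV)"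
        "(\<lambda>\<omega>. pos i \<omega> j) \<in> measurable M (count_space UNIV)" using that meas by auto
      have "(\<lambda>\<omega>. pos (Suc i) \<omega> j - pos i \<omega> j) \<in> measurable M (count_space UNIV)" by measurable
      from measurable_sets[OF this, of "{s i j}"] show ?thesis
        by (simp add: vimage_def Int_def conj_commute)
    qed
    have "{\<omega>\<in>space M. \<forall>i\<in>{..<K}. \<forall>j\<in>{1..d}. pos (Suc i) \<omega> j - pos i \<omega> j = s i j} \<in> events"
      by (intro sets.sets_Collect_finite_All finite_lessThan finite_atLeastAtMost ev) simp_all
    then have I: "?I \<in> events" by (simp only: Ball_def lessThan_iff)
    show ?case
    proof (cases "z = x")
      case True
      then have "S 0 z s = ?I" "path_weight q d x 0 z = 1"
        unfolding eq by (simp_all only: path_weight.simps delta_def if_True simp_thms)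
      then show ?thesis using I increments[of s] by (simp only: atLeast0LessThan simp_thms mult_1)
    next
      case False
      then show ?thesis
        by (simp only: eq path_weight.simps delta_def if_False sets.empty_sets measure_empty mult_zero_left simp_thms)
    qed
  next
    case (Suc k)
    \<comment> \<open>For a predecessor w the increment of cell k must be z - w, which turns the
      last step of the path into one more prescribed increment.\<close>
    let ?s = "\<lambda>w. s(k := \<lambda>j. z j - w j)"
    have eq: "S (Suc k) z s = (if chamber d z then \<Union>w\<in>nbrs d z. S k w (?s w) else {})"
    proof (cases "chamber d z")
      case True
      have "\<omega> \<in> S (Suc k) z s \<longleftrightarrow> (\<exists>w\<in>nbrs d z. \<omega> \<in> S k w (?s w))" if "\<omega> \<in> space M" for \<omega>
      proof -
        have split: "(\<forall>i\<in>{k..<K}. \<forall>j\<in>{1..d}. pos (Suc i) \<omega> j - pos i \<omega> j = ?s w i j) \<longleftrightarrow>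
           (\<forall>j\<in>{1..d}. pos (Suc k) \<omega> j - pos k \<omega> j = z j - w j)
           \<and> (\<forall>i\<in>{Suc k..<K}. \<forall>j\<in>{1..d}. pos (Suc i) \<omega> j - pos i \<omega> j = s i j)" for w
        proof -
          have "{k..<K} = insert k {Suc k..<K}" using Suc.prems by auto
          then show ?thesis by auto
        qed
        have "pos (Suc k) \<omega> = z" if w: "w \<in> nbrs d z" "pos k \<omega> = w"
          and i: "\<forall>j\<in>{1..d}. pos (Suc k) \<omega> j - pos k \<omega> j = z j - w j" for w
        proof
          fix j
          show "pos (Suc k) \<omega> j = z j"
          proof (cases "j \<in> {1..d}")
            \<comment> \<open>Prescribed increments control only the indices 1..d; equality of
              positions as functions also needs the others, which are frozen by \<open>out\<close>
              and unchanged between neighbours.\<close>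
            case False
            then have "w j = z j" using w(1) by (auto simp: nbrs_def)
            then show ?thesis using w(2) out[OF \<open>\<omega> \<in> space M\<close> False] by metis
          next
            case True
            then show ?thesis using bspec[OF i True] w(2) by simp
          qed
        qed
        moreover have "pos k \<omega> = w" if "grid_path d (\<lambda>i. pos i \<omega>) k w" for w
          using that by (simp add: grid_path_def)
        ultimately show ?thesis unfolding S_def mem_Collect_eq split grid_path_Suc
          using True that by (metis (no_types, lifting))
      qed
      moreover have "S k w t \<subseteq> space M" for k w t by (auto simp: S_def)
      ultimately show ?thesis using True by (simp add: set_eq_iff subset_eq) metis
    next
      case False
      then show ?thesis unfolding S_def grid_path_Suc by simp
    qed
    have IH: "S k w (?s w) \<in> events"
      "prob (S k w (?s w)) = path_weight q d x k w
        * (step_weight q d (\<lambda>j. z j - w j) * (\<Prod>i\<in>{Suc k..<K}. step_weight q d (s i)))" for w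
    proof -
      have "(\<Prod>i\<in>{k..<K}. step_weight q d (?s w i))
          = step_weight q d (\<lambda>j. z j - w j) * (\<Prod>i\<in>{Suc k..<K}. step_weight q d (s i))"
        using Suc.prems by (simp add: prod.atLeast_Suc_lessThan)
      moreover have "k \<le> K" using Suc.prems by simp
      ultimately show "S k w (?s w) \<in> events" "prob (S k w (?s w)) = path_weight q d x k w
        * (step_weight q d (\<lambda>j. z j - w j) * (\<Prod>i\<in>{Suc k..<K}. step_weight q d (s i)))"
        using Suc.IH[of w "?s w"] by presburger+
    qed
    have "disjoint_family_on (\<lambda>w. S k w (?s w)) (nbrs d z)"
      by (auto simp: disjoint_family_on_def S_def grid_path_def)
    then have "prob (\<Union>w\<in>nbrs d z. S k w (?s w)) = (\<Sum>w\<in>nbrs d z. prob (S k w (?s w)))"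
      using IH(1) by (intro finite_measure_finite_Union) (auto simp: finite_nbrs)
    then have "prob (\<Union>w\<in>nbrs d z. S k w (?s w))
        = (\<Sum>w\<in>nbrs d z. path_weight q d x k w * step_weight q d (\<lambda>j. z j - w j))
          * (\<Prod>i\<in>{Suc k..<K}. step_weight q d (s i))"
      unfolding IH(2) by (simp only: sum_distrib_right mult.assoc)
    moreover have "(\<Union>w\<in>nbrs d z. S k w (?s w)) \<in> events"
      using IH(1) by (intro sets.finite_UN finite_nbrs)
    ultimately show ?case unfolding eq by simp
  qed
  \<comment> \<open>At k = K no cell with a prescribed increment remains, so the value of s does not
    matter.\<close>
  from this[of K z undefined] show "{\<omega>\<in>space M. grid_path d (\<lambda>i. pos i \<omega>) K z} \<in> events"
    "prob {\<omega>\<in>space M. grid_path d (\<lambda>i. pos i \<omega>) K z} = path_weight q d x K z"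
    by (auto simp: S_def)
qed

section \<open>Increments over the cells of a grid\<close>

text \<open>Polymorphic, since it is applied to integer walks and to natural-number counts. For the
  counts the truncated subtraction is the true difference, because Poisson paths are
  monotone.\<close>

definition cell_inc :: "real \<Rightarrow> (real \<Rightarrow> 'b::minus) \<Rightarrow> nat \<Rightarrow> 'b" where
  "cell_inc h f i = f (real (Suc i) * h) - f (real i * h)"

lemma cell_inc_sample_path:
  "h \<ge> 0 \<Longrightarrow> cell_inc h (sample_path X \<omega>) i = cell_inc h (\<lambda>t. X t \<omega>) i"
  by (simp add: cell_inc_def sample_path_def)

text \<open>Only two coordinates of the path enter. As the values are countable, it suffices to
  treat the difference with one of the two values fixed.\<close>

lemma measurable_cell_inc:
  assumes "h \<ge> 0"
  shows "(\<lambda>f. cell_inc h f i) \<in> measurable path_space (count_space (UNIV :: 'b::{minus,countable} set))"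
proof -
  have c: "(\<lambda>f. f t) \<in> measurable path_space (count_space (UNIV :: 'b set))" if "t \<ge> 0" for t :: real
    using that by (intro measurable_component_singleton) auto
  have "(\<lambda>f. a - f (real i * h)) \<in> measurable path_space (count_space UNIV)" for a :: 'b
    by (rule measurable_compose[OF c, where g = "\<lambda>b. a - b"]) (use assms in auto)
  then show ?thesis unfolding cell_inc_def
    by (rule measurable_compose_countable[where f = "\<lambda>a f. a - f (real i * h)"]) (use assms in \<open>auto intro: c\<close>)
qed

lemma sets_cell_inc:
  assumes "h \<ge> 0"
  shows "{f\<in>space path_space. cell_inc h f i \<in> (A :: 'b::{minus,countable} set)} \<in> sets path_space"
  using measurable_sets[OF measurable_cell_inc[OF assms], of A i]
  by (simp add: vimage_def Int_def conj_commute)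

lemma sets_all_cell_inc:
  assumes "h \<ge> 0"
  shows "{f\<in>space path_space. \<forall>i<K. cell_inc h f i = (a i :: 'b::{minus,countable})} \<in> sets path_space"
proof -
  have "{f\<in>space path_space. \<forall>i\<in>{..<K}. cell_inc h f i = a i} \<in> sets path_space"
    using sets_cell_inc[OF assms, of _ "{a _}"] by (intro sets.sets_Collect_finite_All) auto
  then show ?thesis by (simp only: Ball_def lessThan_iff)
qed

section \<open>Poisson and Skellam laws of the increments\<close>

definition poisson_mass :: "real \<Rightarrow> nat \<Rightarrow> real" where
  "poisson_mass r k = r ^ k / fact k * exp (- r)"

lemma poisson_mass_nonneg: "r \<ge> 0 \<Longrightarrow> poisson_mass r k \<ge> 0"
  by (simp add: poisson_mass_def)

lemma poisson_process_increment:
  assumes N: "poisson_process M \<rho> N" and st: "0 \<le> s" "s < t"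
  shows "measure M {\<omega>\<in>space M. N t \<omega> - N s \<omega> \<in> A} = measure (measure_pmf (poisson_pmf (\<rho> * (t - s)))) A"
proof -
  have m: "N t \<in> measurable M (count_space UNIV)" "N s \<in> measurable M (count_space UNIV)"
    using N st by (auto simp: poisson_process_def)
  have "(\<lambda>\<omega>. N t \<omega> - N s \<omega>) \<in> measurable M (count_space UNIV)"
    using m by measurable
  then have "measure (distr M (count_space UNIV) (\<lambda>\<omega>. N t \<omega> - N s \<omega>)) A
      = measure M {\<omega>\<in>space M. N t \<omega> - N s \<omega> \<in> A}"
    by (subst measure_distr) (auto intro!: arg_cong[where f = "measure M"])
  moreover have "distr M (count_space UNIV) (\<lambda>\<omega>. N t \<omega> - N s \<omega>) = measure_pmf (poisson_pmf (\<rho> * (t - s)))"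
    using N st by (auto simp: poisson_process_def)
  ultimately show ?thesis by simp
qed

lemma poisson_process_cell_inc:
  assumes N: "poisson_process M \<rho> N" and h: "h > 0"
  shows "measure M {\<omega>\<in>space M. cell_inc h (\<lambda>t. N t \<omega>) i \<in> A} = measure (measure_pmf (poisson_pmf (\<rho> * h))) A"
  using poisson_process_increment[OF N, of "real i * h" "real (Suc i) * h" A] h
  by (simp add: cell_inc_def algebra_simps)

lemma poisson_process_cell_incs:
  assumes N: "poisson_process M \<rho> N" and h: "h > 0"
  shows "measure M {\<omega>\<in>space M. \<forall>i<K. cell_inc h (\<lambda>t. N t \<omega>) i = a i} = (\<Prod>i<K. poisson_mass (\<rho> * h) (a i))"
proof -
  interpret prob_space M using N by (simp add: poisson_process_def)
  have \<rho>: "\<rho> * h > 0" using N h by (simp add: poisson_process_def)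
  have single: "prob {\<omega>\<in>space M. cell_inc h (\<lambda>t. N t \<omega>) i = a i} = poisson_mass (\<rho> * h) (a i)" for i
    using poisson_process_cell_inc[OF N h, of i "{a i}"] \<rho>
    by (simp add: poisson_mass_def measure_pmf_single)
  show ?thesis
  proof (cases "K = 0")
    case True
    then show ?thesis by (simp add: prob_space)
  next
    case False
    have "indep_vars (\<lambda>_. count_space UNIV) (\<lambda>i \<omega>. cell_inc h (\<lambda>t. N t \<omega>) i) {..<K}"
      unfolding cell_inc_def using N[unfolded poisson_process_def] h
      by (auto dest!: spec[of _ K] spec[of _ "\<lambda>i. real i * h"])
    then have "prob (\<Inter>i\<in>{..<K}. (\<lambda>\<omega>. cell_inc h (\<lambda>t. N t \<omega>) i) -` {a i} \<inter> space M)
      = (\<Prod>i<K. prob ((\<lambda>\<omega>. cell_inc h (\<lambda>t. N t \<omega>) i) -` {a i} \<inter> space M))"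
      using False by (intro indep_varsD_finite) auto
    moreover have "(\<Inter>i\<in>{..<K}. (\<lambda>\<omega>. cell_inc h (\<lambda>t. N t \<omega>) i) -` {a i} \<inter> space M)
      = {\<omega>\<in>space M. \<forall>i<K. cell_inc h (\<lambda>t. N t \<omega>) i = a i}"
      using False by auto
    moreover have "(\<lambda>\<omega>. cell_inc h (\<lambda>t. N t \<omega>) i) -` {a i} \<inter> space M
      = {\<omega>\<in>space M. cell_inc h (\<lambda>t. N t \<omega>) i = a i}" for i by auto
    ultimately show ?thesis using single by simp
  qed
qed

text \<open>The Skellam law of the difference of two independent Poisson variables of mean r,
  classically exp(-2r) I_|s|(2r) with a modified Bessel function. The index m is the value of the
  first variable, and the guard keeps the second one, m - s, from being negative.\<close>

definition skellam_mass :: "real \<Rightarrow> int \<Rightarrow> real" where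
  "skellam_mass r s = (\<Sum>m. if s \<le> int m then poisson_mass r m * poisson_mass r (nat (int m - s)) else 0)"

lemma poisson_mass_sums: "poisson_mass r sums 1"
proof -
  have "(\<lambda>k. exp (- r) * (r ^ k /\<^sub>R fact k)) sums (exp (- r) * exp r)"
    by (intro sums_mult exp_converges)
  then show ?thesis unfolding poisson_mass_def by (simp add: exp_minus field_simps)
qed

lemma poisson_mass_le_1:
  assumes "r \<ge> 0" shows "poisson_mass r k \<le> 1"
  using sum_le_suminf[of "poisson_mass r" "{k}"] poisson_mass_sums[of r] poisson_mass_nonneg[OF assms]
  by (auto simp: sums_iff)

lemma skellam_sums:
  assumes "r \<ge> 0"
  shows "(\<lambda>m. if s \<le> int m then poisson_mass r m * poisson_mass r (nat (int m - s)) else 0) sums skellam_mass r s"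
  unfolding skellam_mass_def
proof (rule summable_sums, rule summable_comparison_test)
  show "\<exists>N. \<forall>m\<ge>N. norm (if s \<le> int m then poisson_mass r m * poisson_mass r (nat (int m - s)) else 0) \<le> poisson_mass r m"
    using poisson_mass_nonneg[OF assms] poisson_mass_le_1[OF assms]
    by (auto simp: abs_mult intro!: mult_left_le)
qed (use poisson_mass_sums in \<open>auto simp: sums_iff\<close>)

text \<open>The sum is exp(-2r) times the series of r^(2m) / (m!)^2. Its first term gives the lower
  bound; replacing one m! by 1 turns it into the series of exp(r^2).\<close>

lemma skellam_mass_0_bounds:
  assumes "r \<ge> 0"
  shows "exp (- (2 * r)) \<le> skellam_mass r 0" "skellam_mass r 0 \<le> exp (- (2 * r)) * exp (r\<^sup>2)"
proof -
  have s: "(\<lambda>m. poisson_mass r m * poisson_mass r m) sums skellam_mass r 0"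
    using skellam_sums[OF assms, of 0] by simp
  have e: "exp (- r) * exp (- r) = exp (- (2 * r))" by (simp flip: exp_add)
  have "(\<Sum>m\<in>{0}. poisson_mass r m * poisson_mass r m) \<le> skellam_mass r 0"
    unfolding sums_unique[OF s] using poisson_mass_nonneg[OF assms]
    by (intro sum_le_suminf sums_summable[OF s]) auto
  then show "exp (- (2 * r)) \<le> skellam_mass r 0" using e by (simp add: poisson_mass_def)
  have "poisson_mass r m * poisson_mass r m \<le> exp (- (2 * r)) * ((r\<^sup>2) ^ m /\<^sub>R fact m)" for m
  proof -
    have "poisson_mass r m * poisson_mass r m = exp (- (2 * r)) * ((r\<^sup>2) ^ m / (fact m * fact m))"
      unfolding poisson_mass_def e[symmetric] by (simp add: power_mult_distrib power2_eq_square field_simps)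
    also have "\<dots> \<le> exp (- (2 * r)) * ((r\<^sup>2) ^ m / fact m)"
      by (intro mult_left_mono divide_left_mono) (auto simp: fact_ge_1)
    finally show ?thesis by (simp add: field_simps)
  qed
  moreover have "(\<lambda>m. exp (- (2 * r)) * ((r\<^sup>2) ^ m /\<^sub>R fact m)) sums (exp (- (2 * r)) * exp (r\<^sup>2))"
    by (intro sums_mult exp_converges)
  ultimately show "skellam_mass r 0 \<le> exp (- (2 * r)) * exp (r\<^sup>2)"
    using s by (intro sums_le[OF _ s]) auto
qed

text \<open>For both signs the series is that of r^(2m+1) / (m! (m+1)!). After the factor r is taken
  out, the two bounds arise as for s = 0.\<close>

lemma skellam_mass_1_bounds:
  assumes "r \<ge> 0" "s \<in> {1, -1}"
  shows "exp (- (2 * r)) * r \<le> skellam_mass r s" "skellam_mass r s \<le> exp (- (2 * r)) * r * exp (r\<^sup>2)"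
proof -
  have s: "(\<lambda>m. poisson_mass r m * poisson_mass r (Suc m)) sums skellam_mass r s"
  proof (cases "s = 1")
    case True
    \<comment> \<open>The guard kills the term m = 0, so the series may start at 1; the shift makes
      it the same as for s = -1.\<close>
    have "(\<lambda>m. if 1 \<le> int (Suc m) then poisson_mass r (Suc m) * poisson_mass r (nat (int (Suc m) - 1)) else 0)
      sums skellam_mass r 1"
      using skellam_sums[OF assms(1), of 1] by (subst sums_Suc_iff) simp
    then show ?thesis using True by (simp add: mult.commute)
  next
    case False
    then have "s = -1" using assms by simp
    moreover have "nat (int m - - 1) = Suc m" for m by simp
    ultimately show ?thesis using skellam_sums[OF assms(1), of s] by simp
  qed
  have e: "exp (- r) * exp (- r) = exp (- (2 * r))" by (simp flip: exp_add)
  have "(\<Sum>m\<in>{0}. poisson_mass r m * poisson_mass r (Suc m)) \<le> skellam_mass r s"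
    unfolding sums_unique[OF s] using poisson_mass_nonneg[OF assms(1)]
    by (intro sum_le_suminf sums_summable[OF s]) auto
  then show "exp (- (2 * r)) * r \<le> skellam_mass r s"
    unfolding e[symmetric] by (simp add: poisson_mass_def mult_ac)
  have "poisson_mass r m * poisson_mass r (Suc m) \<le> exp (- (2 * r)) * r * ((r\<^sup>2) ^ m /\<^sub>R fact m)" for m
  proof -
    have "poisson_mass r m * poisson_mass r (Suc m) = exp (- (2 * r)) * r * ((r\<^sup>2) ^ m / (fact m * fact (Suc m)))"
      unfolding poisson_mass_def e[symmetric]
      by (simp add: power_mult_distrib power2_eq_square field_simps del: fact_Suc)
    also have "\<dots> \<le> exp (- (2 * r)) * r * ((r\<^sup>2) ^ m / fact m)"
      using assms(1) by (intro mult_left_mono divide_left_mono) (auto simp: fact_ge_1 simp del: fact_Suc)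
    finally show ?thesis by (simp add: field_simps)
  qed
  moreover have "(\<lambda>m. exp (- (2 * r)) * r * ((r\<^sup>2) ^ m /\<^sub>R fact m)) sums (exp (- (2 * r)) * r * exp (r\<^sup>2))"
    by (intro sums_mult exp_converges)
  ultimately show "skellam_mass r s \<le> exp (- (2 * r)) * r * exp (r\<^sup>2)"
    using s by (intro sums_le[OF _ s]) auto
qed

text \<open>Cells are converted one at a time: in \<open>S k a b\<close> the first k cells prescribe
  only the difference and the others both counts. Countable additivity over the first count of cell
  k then produces one Skellam factor, so joint point probabilities are all that is needed.\<close>

lemma (in prob_space) prob_differences:
  fixes I J :: "nat \<Rightarrow> 'a \<Rightarrow> nat"
  assumes r: "r \<ge> 0"
    and meas: "\<And>i. I i \<in> measurable M (count_space UNIV)" "\<And>i. J i \<in> measurable M (count_space UNIV)"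
    and joint: "\<And>a b. prob {\<omega>\<in>space M. \<forall>i<K. I i \<omega> = a i \<and> J i \<omega> = b i}
      = (\<Prod>i<K. poisson_mass r (a i) * poisson_mass r (b i))"
  shows "prob {\<omega>\<in>space M. \<forall>i<K. int (I i \<omega>) - int (J i \<omega>) = s i} = (\<Prod>i<K. skellam_mass r (s i))"
proof -
  define S where "S k a b = {\<omega>\<in>space M. (\<forall>i<k. int (I i \<omega>) - int (J i \<omega>) = s i)
    \<and> (\<forall>i\<in>{k..<K}. I i \<omega> = a i \<and> J i \<omega> = b i)}" for k a b
  let ?f = "\<lambda>a b i. poisson_mass r (a i) * poisson_mass r (b i)"
  note [measurable] = meas
  have S: "S k a b \<in> events" for k a b
    unfolding S_def by measurable
  have "prob (S k a b) = (\<Prod>i<k. skellam_mass r (s i)) * (\<Prod>i\<in>{k..<K}. ?f a b i)" if "k \<le> K" for k a b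
    using that
  proof (induction k arbitrary: a b)
    case 0
    have "S 0 a b = {\<omega>\<in>space M. \<forall>i<K. I i \<omega> = a i \<and> J i \<omega> = b i}"
      unfolding S_def by (auto simp: Ball_def)
    then show ?case using joint[of a b] by (simp add: atLeast0LessThan)
  next
    case (Suc k)
    let ?b = "\<lambda>m. nat (int m - s k)"
    \<comment> \<open>Once the first count is m, the second must be m - s k. The empty set for m < s
      k matches the guard in \<open>skellam_mass\<close>.\<close>
    let ?A = "\<lambda>m. if s k \<le> int m then S k (a(k := m)) (b(k := ?b m)) else {}"
    have cell: "{k..<K} = insert k {Suc k..<K}" using Suc.prems by auto
    have "S (Suc k) a b = (\<Union>m. ?A m)"
    proof (intro set_eqI iffI)
      fix \<omega> assume \<omega>: "\<omega> \<in> S (Suc k) a b"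
      then have "int (I k \<omega>) - int (J k \<omega>) = s k" by (auto simp: S_def)
      then have "s k \<le> int (I k \<omega>)" "?b (I k \<omega>) = J k \<omega>" by auto
      moreover have "\<omega> \<in> S k (a(k := I k \<omega>)) (b(k := J k \<omega>))"
        using \<omega> unfolding S_def cell by auto
      ultimately show "\<omega> \<in> (\<Union>m. ?A m)" by (intro UN_I[of "I k \<omega>"]) auto
    next
      fix \<omega> assume "\<omega> \<in> (\<Union>m. ?A m)"
      then obtain m where m: "s k \<le> int m" "\<omega> \<in> S k (a(k := m)) (b(k := ?b m))"
        by (auto split: if_splits)
      then have "I k \<omega> = m" "J k \<omega> = ?b m" unfolding S_def cell by auto
      then have "int (I k \<omega>) - int (J k \<omega>) = s k" using m(1) by simp
      then show "\<omega> \<in> S (Suc k) a b" using m(2) unfolding S_def cell by (auto simp: less_Suc_eq)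
    qed
    moreover have "disjoint_family ?A"
      unfolding disjoint_family_on_def S_def cell by auto
    ultimately have "(\<lambda>m. prob (?A m)) sums prob (S (Suc k) a b)"
      using finite_measure_UNION[of ?A] S by (simp only: image_subset_iff sets.empty_sets split: if_split) simp
    moreover have "prob (?A m) = (\<Prod>i<k. skellam_mass r (s i)) * (\<Prod>i\<in>{Suc k..<K}. ?f a b i)
      * (if s k \<le> int m then poisson_mass r m * poisson_mass r (?b m) else 0)" for m
    proof -
      have "(\<Prod>i\<in>{k..<K}. ?f (a(k := m)) (b(k := ?b m)) i)
          = poisson_mass r m * poisson_mass r (?b m) * (\<Prod>i\<in>{Suc k..<K}. ?f a b i)"
        unfolding cell by (subst prod.insert) (auto intro!: prod.cong)
      moreover have "k \<le> K" using Suc.prems by simp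
      ultimately have "prob (S k (a(k := m)) (b(k := ?b m))) = (\<Prod>i<k. skellam_mass r (s i))
          * (poisson_mass r m * poisson_mass r (?b m) * (\<Prod>i\<in>{Suc k..<K}. ?f a b i))"
        using Suc.IH[of "a(k := m)" "b(k := ?b m)"] by presburger
      then show ?thesis by (simp only: split: if_split) simp
    qed
    ultimately have "(\<lambda>m. (\<Prod>i<k. skellam_mass r (s i)) * (\<Prod>i\<in>{Suc k..<K}. ?f a b i)
      * (if s k \<le> int m then poisson_mass r m * poisson_mass r (?b m) else 0)) sums prob (S (Suc k) a b)"
      by (simp only:)
    with sums_mult[OF skellam_sums[OF r, of "s k"]]
    have "prob (S (Suc k) a b) = (\<Prod>i<k. skellam_mass r (s i)) * (\<Prod>i\<in>{Suc k..<K}. ?f a b i) * skellam_mass r (s k)"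
      by (rule sums_unique2[rotated])
    then show ?case by (simp add: mult_ac)
  qed
  from this[of K] show ?thesis by (simp add: S_def)
qed

lemma poisson_process_mono:
  assumes "poisson_process M \<rho> N" "\<omega> \<in> space M" "0 \<le> s" "s \<le> t"
  shows "N s \<omega> \<le> N t \<omega>"
proof -
  have "mono_on {0..} (\<lambda>t. N t \<omega>)" using assms by (auto simp: poisson_process_def)
  from mono_onD[OF this, of s t] show ?thesis using assms by simp
qed

lemma random_walk_cell_incs:
  assumes X: "random_walk M x X" and h: "h > 0"
  shows "measure M {\<omega>\<in>space M. \<forall>i<K. cell_inc h (\<lambda>t. X t \<omega>) i = s i} = (\<Prod>i<K. skellam_mass (h / 2) (s i))"
proof -
  obtain N\<^sub>1 N\<^sub>2 where N: "poisson_process M (1/2) N\<^sub>1" "poisson_process M (1/2) N\<^sub>2"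
    and indep: "prob_space.indep_var M path_space (sample_path N\<^sub>1) path_space (sample_path N\<^sub>2)"
    and XN: "\<And>t \<omega>. t \<ge> 0 \<Longrightarrow> \<omega> \<in> space M \<Longrightarrow> X t \<omega> = x + int (N\<^sub>1 t \<omega>) - int (N\<^sub>2 t \<omega>)"
    using X unfolding random_walk_def by blast
  interpret prob_space M using N by (simp add: poisson_process_def)
  let ?I = "\<lambda>i \<omega>. cell_inc h (\<lambda>t. N\<^sub>1 t \<omega>) i" and ?J = "\<lambda>i \<omega>. cell_inc h (\<lambda>t. N\<^sub>2 t \<omega>) i"
  have rv: "sample_path N\<^sub>1 \<in> measurable M path_space" "sample_path N\<^sub>2 \<in> measurable M path_space"
    using indep_var_rv1[OF indep] indep_var_rv2[OF indep] by auto
  have sp: "cell_inc h (sample_path N \<omega>) i = cell_inc h (\<lambda>t. N t \<omega>) i" for N :: "real \<Rightarrow> 'a \<Rightarrow> nat" and i \<omega>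
    using h by (simp add: cell_inc_sample_path)
  have meas: "?I i \<in> measurable M (count_space UNIV)" "?J i \<in> measurable M (count_space UNIV)" for i
    using measurable_compose[OF rv(1) measurable_cell_inc[of h i]]
      measurable_compose[OF rv(2) measurable_cell_inc[of h i]] h by (simp_all add: sp)
  have "prob {\<omega>\<in>space M. \<forall>i<K. ?I i \<omega> = a i \<and> ?J i \<omega> = b i}
    = (\<Prod>i<K. poisson_mass (h / 2) (a i) * poisson_mass (h / 2) (b i))" for a b
  proof -
    let ?A = "\<lambda>a. {f\<in>space path_space. \<forall>i<K. cell_inc h f i = (a i :: nat)}"
    have "prob ((\<lambda>\<omega>. (sample_path N\<^sub>1 \<omega>, sample_path N\<^sub>2 \<omega>)) -` (?A a \<times> ?A b) \<inter> space M)
      = prob (sample_path N\<^sub>1 -` ?A a \<inter> space M) * prob (sample_path N\<^sub>2 -` ?A b \<inter> space M)"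
      using h by (intro indep_varD[OF indep] sets_all_cell_inc) auto
    moreover have "(\<lambda>\<omega>. (sample_path N\<^sub>1 \<omega>, sample_path N\<^sub>2 \<omega>)) -` (?A a \<times> ?A b) \<inter> space M
      = {\<omega>\<in>space M. \<forall>i<K. ?I i \<omega> = a i \<and> ?J i \<omega> = b i}"
      using measurable_space[OF rv(1)] measurable_space[OF rv(2)] by (auto simp: sp)
    moreover have "sample_path N\<^sub>1 -` ?A a \<inter> space M = {\<omega>\<in>space M. \<forall>i<K. ?I i \<omega> = a i}"
      "sample_path N\<^sub>2 -` ?A b \<inter> space M = {\<omega>\<in>space M. \<forall>i<K. ?J i \<omega> = b i}"
      using measurable_space[OF rv(1)] measurable_space[OF rv(2)] by (auto simp: sp)
    ultimately show ?thesis
      using poisson_process_cell_incs[OF N(1) h] poisson_process_cell_incs[OF N(2) h]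
      by (simp add: prod.distrib)
  qed
  with h meas have "prob {\<omega>\<in>space M. \<forall>i<K. int (?I i \<omega>) - int (?J i \<omega>) = s i} = (\<Prod>i<K. skellam_mass (h / 2) (s i))"
    by (intro prob_differences) auto
  \<comment> \<open>Monotone counts make the truncated differences genuine, so they may be
    subtracted as integers.\<close>
  moreover have "cell_inc h (\<lambda>t. X t \<omega>) i = int (?I i \<omega>) - int (?J i \<omega>)" if "\<omega> \<in> space M" for \<omega> i
  proof -
    have "N\<^sub>1 (real i * h) \<omega> \<le> N\<^sub>1 (real (Suc i) * h) \<omega>" "N\<^sub>2 (real i * h) \<omega> \<le> N\<^sub>2 (real (Suc i) * h) \<omega>"
      using h by (intro poisson_process_mono[OF N(1) that] poisson_process_mono[OF N(2) that]; simp add: mult_right_mono)+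
    then show ?thesis using h by (simp add: cell_inc_def XN that)
  qed
  then have "{\<omega>\<in>space M. \<forall>i<K. cell_inc h (\<lambda>t. X t \<omega>) i = s i}
    = {\<omega>\<in>space M. \<forall>i<K. int (?I i \<omega>) - int (?J i \<omega>) = s i}"
    by (intro Collect_cong conj_cong refl) simp
  ultimately show ?thesis by simp
qed

lemma independent_random_walks_cell_incs:
  assumes X: "independent_random_walks M d x X" and h: "h > 0" and d: "d \<ge> 1"
  shows "measure M {\<omega>\<in>space M. \<forall>i<K. \<forall>j\<in>{1..d}. cell_inc h (\<lambda>t. X j t \<omega>) i = s i j}
    = (\<Prod>i<K. step_weight (skellam_mass (h / 2)) d (s i))"
proof -
  interpret prob_space M using X by (simp add: independent_random_walks_def)
  have indep: "indep_vars (\<lambda>_. path_space) (\<lambda>j. sample_path (X j)) {1..d}"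
    and rw: "\<And>j. j \<in> {1..d} \<Longrightarrow> random_walk M (x j) (X j)"
    using X by (auto simp: independent_random_walks_def)
  let ?A = "\<lambda>j. {f\<in>space path_space. \<forall>i<K. cell_inc h f i = s i j}"
  have sp: "sample_path (X j) -` ?A j \<inter> space M = {\<omega>\<in>space M. \<forall>i<K. cell_inc h (\<lambda>t. X j t \<omega>) i = s i j}"
    if "j \<in> {1..d}" for j
  proof -
    have "sample_path (X j) \<in> measurable M path_space"
      using indep that by (auto simp: indep_vars_def)
    from measurable_space[OF this] show ?thesis using h by (auto simp: cell_inc_sample_path)
  qed
  have "prob (\<Inter>j\<in>{1..d}. sample_path (X j) -` ?A j \<inter> space M)
    = (\<Prod>j\<in>{1..d}. prob (sample_path (X j) -` ?A j \<inter> space M))"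
    using h d by (intro indep_varsD_finite[OF indep] sets_all_cell_inc) auto
  also have "(\<Inter>j\<in>{1..d}. sample_path (X j) -` ?A j \<inter> space M)
    = (\<Inter>j\<in>{1..d}. {\<omega>\<in>space M. \<forall>i<K. cell_inc h (\<lambda>t. X j t \<omega>) i = s i j})"
    by (intro INF_cong refl sp)
  also have "\<dots> = {\<omega>\<in>space M. \<forall>i<K. \<forall>j\<in>{1..d}. cell_inc h (\<lambda>t. X j t \<omega>) i = s i j}"
    using d by fastforce
  also have "(\<Prod>j\<in>{1..d}. prob (sample_path (X j) -` ?A j \<inter> space M))
    = (\<Prod>j\<in>{1..d}. \<Prod>i<K. skellam_mass (h / 2) (s i j))"
    by (intro prod.cong refl) (simp only: sp random_walk_cell_incs[OF rw h])
  also have "\<dots> = (\<Prod>i<K. step_weight (skellam_mass (h / 2)) d (s i))"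
    unfolding step_weight_def by (rule prod.swap)
  finally show ?thesis .
qed

section \<open>Cells with at most one jump\<close>

lemma poisson_tails:
  assumes "r > 0"
  shows "measure (measure_pmf (poisson_pmf r)) {1..} \<le> r"
    and "measure (measure_pmf (poisson_pmf r)) {2..} \<le> r\<^sup>2"
proof -
  have e: "1 - r \<le> exp (- r)" using exp_ge_add_one_self[of "- r"] by simp
  have "{1..} = UNIV - {0::nat}" by auto
  then have "measure (measure_pmf (poisson_pmf r)) {1..} = 1 - exp (- r)"
    using measure_pmf.prob_compl[of "{0}" "poisson_pmf r"] assms by (simp add: measure_pmf_single)
  then show "measure (measure_pmf (poisson_pmf r)) {1..} \<le> r" using e by simp
  have "{2..} = UNIV - {0, 1::nat}" by auto
  then have "measure (measure_pmf (poisson_pmf r)) {2..} = 1 - (1 + r) * exp (- r)"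
    using measure_pmf.prob_compl[of "{0, 1}" "poisson_pmf r"] assms
    by (simp add: measure_measure_pmf_finite algebra_simps)
  \<comment> \<open>The left side is 1 - r^2, so the chance of two or more jumps is of second order
    in r.\<close>
  moreover have "(1 + r) * (1 - r) \<le> (1 + r) * exp (- r)"
    using e assms by (intro mult_left_mono) auto
  ultimately show "measure (measure_pmf (poisson_pmf r)) {2..} \<le> r\<^sup>2"
    by (simp add: algebra_simps power2_eq_square)
qed

text \<open>Inside such a cell the path shows no value besides its two end values, so that a grid
  sees everything; the bound on the increment makes the move a nearest-neighbour step.\<close>

definition quiet_cell :: "real \<Rightarrow> (real \<Rightarrow> int) \<Rightarrow> nat \<Rightarrow> bool" where
  "quiet_cell h f i \<longleftrightarrow> \<bar>cell_inc h f i\<bar> \<le> 1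
    \<and> (\<forall>t\<in>{real i * h..real (Suc i) * h}. f t = f (real i * h) \<or> f t = f (real (Suc i) * h))"

lemma random_walk_quiet:
  assumes X: "random_walk M x X" and h: "h > 0"
  obtains B where "B \<in> sets M" "measure M B \<le> h\<^sup>2"
    "\<And>\<omega>. \<omega> \<in> space M - B \<Longrightarrow> quiet_cell h (\<lambda>t. X t \<omega>) i"
    "measure M {\<omega>\<in>space M. cell_inc h (\<lambda>t. X t \<omega>) i \<noteq> 0} \<le> h"
proof -
  obtain N\<^sub>1 N\<^sub>2 where N: "poisson_process M (1/2) N\<^sub>1" "poisson_process M (1/2) N\<^sub>2"
    and indep: "prob_space.indep_var M path_space (sample_path N\<^sub>1) path_space (sample_path N\<^sub>2)"
    and XN: "\<And>t \<omega>. t \<ge> 0 \<Longrightarrow> \<omega> \<in> space M \<Longrightarrow> X t \<omega> = x + int (N\<^sub>1 t \<omega>) - int (N\<^sub>2 t \<omega>)"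
    using X unfolding random_walk_def by blast
  interpret prob_space M using N by (simp add: poisson_process_def)
  let ?a = "real i * h" and ?b = "real (Suc i) * h"
  let ?I = "\<lambda>\<omega>. cell_inc h (\<lambda>t. N\<^sub>1 t \<omega>) i" and ?J = "\<lambda>\<omega>. cell_inc h (\<lambda>t. N\<^sub>2 t \<omega>) i"
  have rv: "sample_path N\<^sub>1 \<in> measurable M path_space" "sample_path N\<^sub>2 \<in> measurable M path_space"
    using indep_var_rv1[OF indep] indep_var_rv2[OF indep] by auto
  have sp: "cell_inc h (sample_path N \<omega>) i = cell_inc h (\<lambda>t. N t \<omega>) i" for N :: "real \<Rightarrow> 'a \<Rightarrow> nat" and i \<omega>
    using h by (simp add: cell_inc_sample_path)
  have [measurable]: "?I \<in> measurable M (count_space UNIV)" "?J \<in> measurable M (count_space UNIV)"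
    using measurable_compose[OF rv(1) measurable_cell_inc[of h i]]
      measurable_compose[OF rv(2) measurable_cell_inc[of h i]] h by (simp_all add: sp)
  let ?E = "\<lambda>F A. {\<omega>\<in>space M. F \<omega> \<in> A}"
  have ev: "?E ?I A \<in> events" "?E ?J A \<in> events" for A
    by measurable
  have pr: "prob (?E ?I A) = measure (measure_pmf (poisson_pmf (h / 2))) A"
    "prob (?E ?J A) = measure (measure_pmf (poisson_pmf (h / 2))) A" for A
    using poisson_process_cell_inc[OF N(1) h, of i A] poisson_process_cell_inc[OF N(2) h, of i A] by simp_all
  have h2: "h / 2 > 0" using h by simp
  have p1: "prob (?E ?I {1..}) \<le> h / 2" "prob (?E ?J {1..}) \<le> h / 2"
    and p2: "prob (?E ?I {2..}) \<le> (h / 2)\<^sup>2" "prob (?E ?J {2..}) \<le> (h / 2)\<^sup>2"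
    unfolding pr by (rule poisson_tails[OF h2])+
  have both: "prob (?E ?I {1..} \<inter> ?E ?J {1..}) \<le> (h / 2)\<^sup>2"
  proof -
    let ?A = "{f\<in>space path_space. cell_inc h f i \<in> {1::nat..}}"
    have "prob ((\<lambda>\<omega>. (sample_path N\<^sub>1 \<omega>, sample_path N\<^sub>2 \<omega>)) -` (?A \<times> ?A) \<inter> space M)
      = prob (sample_path N\<^sub>1 -` ?A \<inter> space M) * prob (sample_path N\<^sub>2 -` ?A \<inter> space M)"
      using h by (intro indep_varD[OF indep] sets_cell_inc) auto
    moreover have "(\<lambda>\<omega>. (sample_path N\<^sub>1 \<omega>, sample_path N\<^sub>2 \<omega>)) -` (?A \<times> ?A) \<inter> space M
      = ?E ?I {1..} \<inter> ?E ?J {1..}"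
      using measurable_space[OF rv(1)] measurable_space[OF rv(2)] by (auto simp: sp)
    moreover have "sample_path N\<^sub>1 -` ?A \<inter> space M = ?E ?I {1..}" "sample_path N\<^sub>2 -` ?A \<inter> space M = ?E ?J {1..}"
      using measurable_space[OF rv(1)] measurable_space[OF rv(2)] by (auto simp: sp)
    ultimately have "prob (?E ?I {1..} \<inter> ?E ?J {1..}) = prob (?E ?I {1..}) * prob (?E ?J {1..})"
      by simp
    also have "\<dots> \<le> (h / 2)\<^sup>2" unfolding power2_eq_square
      using p1 h by (intro mult_mono) auto
    finally show ?thesis .
  qed
  \<comment> \<open>Off this event the two counts increase by at most one in total. Each of the
    three parts has probability at most (h/2)^2, and 3/4 h^2 \<le> h^2.\<close>
  let ?B = "?E ?I {2..} \<union> ?E ?J {2..} \<union> (?E ?I {1..} \<inter> ?E ?J {1..})"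
  have B: "?B \<in> events" using ev by auto
  have "prob ?B \<le> prob (?E ?I {2..} \<union> ?E ?J {2..}) + prob (?E ?I {1..} \<inter> ?E ?J {1..})"
    using ev by (intro measure_Un_le) auto
  also have "\<dots> \<le> prob (?E ?I {2..}) + prob (?E ?J {2..}) + prob (?E ?I {1..} \<inter> ?E ?J {1..})"
    using ev by (intro add_right_mono measure_Un_le) auto
  also have "\<dots> \<le> (h / 2)\<^sup>2 + (h / 2)\<^sup>2 + (h / 2)\<^sup>2"
    using p2 both by (intro add_mono) auto
  also have "\<dots> \<le> h\<^sup>2" by (simp add: power2_eq_square)
  finally have PB: "prob ?B \<le> h\<^sup>2" .
  have mono: "N\<^sub>1 s \<omega> \<le> N\<^sub>1 t \<omega>" "N\<^sub>2 s \<omega> \<le> N\<^sub>2 t \<omega>" if "\<omega> \<in> space M" "0 \<le> s" "s \<le> t" for s t \<omega>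
    using poisson_process_mono[OF N(1) that] poisson_process_mono[OF N(2) that] by blast+
  have ab: "0 \<le> ?a" "?a \<le> ?b" using h by (auto simp: mult_right_mono)
  have quiet: "quiet_cell h (\<lambda>t. X t \<omega>) i" if "\<omega> \<in> space M - ?B" for \<omega>
  proof -
    have \<omega>: "\<omega> \<in> space M" using that by auto
    have one: "?I \<omega> + ?J \<omega> \<le> 1" using that by fastforce
    have "X t \<omega> = X ?a \<omega> \<or> X t \<omega> = X ?b \<omega>" if t: "t \<in> {?a..?b}" for t
    proof -
      have "N\<^sub>1 ?a \<omega> \<le> N\<^sub>1 t \<omega>" "N\<^sub>1 t \<omega> \<le> N\<^sub>1 ?b \<omega>" "N\<^sub>2 ?a \<omega> \<le> N\<^sub>2 t \<omega>" "N\<^sub>2 t \<omega> \<le> N\<^sub>2 ?b \<omega>"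
        using \<omega> t ab by (auto intro!: mono)
      moreover have "X s \<omega> = x + int (N\<^sub>1 s \<omega>) - int (N\<^sub>2 s \<omega>)" if "s \<in> {?a, ?b, t}" for s
        using that t ab \<omega> by (intro XN) auto
      ultimately show ?thesis using one by (auto simp: cell_inc_def)
    qed
    moreover have "\<bar>cell_inc h (\<lambda>t. X t \<omega>) i\<bar> \<le> 1"
    proof -
      have "N\<^sub>1 ?a \<omega> \<le> N\<^sub>1 ?b \<omega>" "N\<^sub>2 ?a \<omega> \<le> N\<^sub>2 ?b \<omega>" using \<omega> ab by (auto intro!: mono)
      moreover have "X s \<omega> = x + int (N\<^sub>1 s \<omega>) - int (N\<^sub>2 s \<omega>)" if "s \<in> {?a, ?b}" for s
        using that ab \<omega> by (intro XN) auto
      ultimately show ?thesis using one unfolding cell_inc_def by auto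
    qed
    ultimately show ?thesis unfolding quiet_cell_def by blast
  qed
  have "{\<omega>\<in>space M. cell_inc h (\<lambda>t. X t \<omega>) i \<noteq> 0} \<subseteq> ?E ?I {1..} \<union> ?E ?J {1..}"
  proof
    fix \<omega> assume \<omega>: "\<omega> \<in> {\<omega>\<in>space M. cell_inc h (\<lambda>t. X t \<omega>) i \<noteq> 0}"
    then have "N\<^sub>1 ?a \<omega> \<le> N\<^sub>1 ?b \<omega>" "N\<^sub>2 ?a \<omega> \<le> N\<^sub>2 ?b \<omega>" using ab by (auto intro!: mono)
    moreover have "X s \<omega> = x + int (N\<^sub>1 s \<omega>) - int (N\<^sub>2 s \<omega>)" if "s \<in> {?a, ?b}" for s
      using that ab \<omega> by (intro XN) auto
    ultimately show "\<omega> \<in> ?E ?I {1..} \<union> ?E ?J {1..}"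
      using \<omega> unfolding cell_inc_def by auto
  qed
  then have "prob {\<omega>\<in>space M. cell_inc h (\<lambda>t. X t \<omega>) i \<noteq> 0} \<le> prob (?E ?I {1..} \<union> ?E ?J {1..})"
    using ev by (intro finite_measure_mono) auto
  also have "\<dots> \<le> prob (?E ?I {1..}) + prob (?E ?J {1..})"
    using ev by (intro measure_Un_le) auto
  also have "\<dots> \<le> h" using p1 by simp
  finally show ?thesis using that[OF B PB quiet] by blast
qed

section \<open>Regularity of paths and measurability of the event\<close>

lemma random_walk_right_continuous:
  assumes X: "random_walk M x X" and \<omega>: "\<omega> \<in> space M" and t: "t \<ge> 0"
  shows "eventually (\<lambda>s. X s \<omega> = X t \<omega>) (at_right t)"
proof -
  obtain N\<^sub>1 N\<^sub>2 where N: "poisson_process M (1/2) N\<^sub>1" "poisson_process M (1/2) N\<^sub>2"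
    and XN: "\<And>t \<omega>. t \<ge> 0 \<Longrightarrow> \<omega> \<in> space M \<Longrightarrow> X t \<omega> = x + int (N\<^sub>1 t \<omega>) - int (N\<^sub>2 t \<omega>)"
    using X unfolding random_walk_def by blast
  have "eventually (\<lambda>s. N s \<omega> = N t \<omega>) (at_right t)" if "poisson_process M (1/2) N" for N
  proof -
    have "continuous (at_right t) (\<lambda>s. N s \<omega>)"
      using that \<omega> t by (auto simp: poisson_process_def)
    then have "((\<lambda>s. N s \<omega>) \<longlongrightarrow> N t \<omega>) (at_right t)"
      by (simp add: continuous_within)
    \<comment> \<open>Convergence of natural numbers means being eventually constant.\<close>
    then show ?thesis by (simp add: tendsto_discrete)
  qed
  from this[OF N(1)] this[OF N(2)] eventually_at_right_less[of t] show ?thesis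
    by eventually_elim (use t \<omega> in \<open>auto simp: XN\<close>)
qed

lemma random_walk_start:
  assumes "random_walk M x X" "\<omega> \<in> space M"
  shows "X 0 \<omega> = x"
  using assms by (auto simp: random_walk_def poisson_process_def)

lemma random_walk_measurable:
  assumes "random_walk M x X" "t \<ge> 0"
  shows "X t \<in> measurable M (count_space UNIV)"
proof -
  obtain N\<^sub>1 N\<^sub>2 where N: "poisson_process M (1/2) N\<^sub>1" "poisson_process M (1/2) N\<^sub>2"
    and XN: "\<And>t \<omega>. t \<ge> 0 \<Longrightarrow> \<omega> \<in> space M \<Longrightarrow> X t \<omega> = x + int (N\<^sub>1 t \<omega>) - int (N\<^sub>2 t \<omega>)"
    using assms unfolding random_walk_def by blast
  have [measurable]: "N\<^sub>1 t \<in> measurable M (count_space UNIV)" "N\<^sub>2 t \<in> measurable M (count_space UNIV)"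
    using N assms by (auto simp: poisson_process_def)
  have "(\<lambda>\<omega>. x + int (N\<^sub>1 t \<omega>) - int (N\<^sub>2 t \<omega>)) \<in> measurable M (count_space UNIV)" by measurable
  then show ?thesis using XN[OF assms(2)] by (simp cong: measurable_cong)
qed

text \<open>Walks that meet at a time t < T stay together for a short while after t, by
  right-continuity, and hence also meet at a rational time. Countably many times therefore decide
  the event.\<close>

lemma nonintersection_event:
  assumes X: "\<And>j. j \<in> {1..d} \<Longrightarrow> random_walk M (x j) (X j)" and T: "T \<ge> 0"
  shows "{\<omega>\<in>space M. (\<forall>j\<in>{1..d}. X j T \<omega> = y j) \<and> nonintersecting_on d X T \<omega>} \<in> sets M"
proof -
  have meas: "X j t \<in> measurable M (count_space UNIV)" if "j \<in> {1..d}" "t \<ge> 0" for j t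
    using random_walk_measurable[OF X] that by blast
  \<comment> \<open>T is added by hand, since a meeting at T has no later time within the interval
    to witness it.\<close>
  define Q where "Q = insert T ({0..T} \<inter> \<rat>)"
  have Q: "Q \<subseteq> {0..T}" "countable Q" using T by (auto simp: Q_def countable_rat)
  have "(\<forall>t\<in>{0..T}. X i t \<omega> \<noteq> X j t \<omega>) \<longleftrightarrow> (\<forall>t\<in>Q. X i t \<omega> \<noteq> X j t \<omega>)"
    if ij: "i \<in> {1..d}" "j \<in> {1..d}" and \<omega>: "\<omega> \<in> space M" for i j \<omega>
  proof
    assume q: "\<forall>t\<in>Q. X i t \<omega> \<noteq> X j t \<omega>"
    show "\<forall>t\<in>{0..T}. X i t \<omega> \<noteq> X j t \<omega>"
    proof
      fix t assume t: "t \<in> {0..T}"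
      show "X i t \<omega> \<noteq> X j t \<omega>"
      proof (cases "t = T")
        case False
        have "eventually (\<lambda>s. X i s \<omega> = X i t \<omega> \<and> X j s \<omega> = X j t \<omega>) (at_right t)"
          using t random_walk_right_continuous[OF X[OF ij(1)] \<omega>] random_walk_right_continuous[OF X[OF ij(2)] \<omega>]
          by (auto intro: eventually_conj)
        then obtain b where b: "b > t" "\<And>s. t < s \<Longrightarrow> s < b \<Longrightarrow> X i s \<omega> = X i t \<omega> \<and> X j s \<omega> = X j t \<omega>"
          unfolding eventually_at_right_field by blast
        obtain r where r: "r \<in> \<rat>" "t < r" "r < min b T"
          using Rats_dense_in_real[of t "min b T"] b t False by auto
        then have "r \<in> Q" using t by (auto simp: Q_def)
        then show ?thesis using q b(2)[of r] r by auto
      qed (use q in \<open>auto simp: Q_def\<close>)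
    qed
  qed (use Q in auto)
  then have eq: "{\<omega>\<in>space M. (\<forall>j\<in>{1..d}. X j T \<omega> = y j) \<and> nonintersecting_on d X T \<omega>}
    = {\<omega>\<in>space M. (\<forall>j\<in>{1..d}. X j T \<omega> = y j)
        \<and> (\<forall>i\<in>{1..d}. \<forall>j\<in>{1..d}. i \<noteq> j \<longrightarrow> (\<forall>t\<in>Q. X i t \<omega> \<noteq> X j t \<omega>))}"
    unfolding nonintersecting_on_def by (intro Collect_cong conj_cong refl) blast
  have 1: "{\<omega>\<in>space M. X j T \<omega> = y j} \<in> sets M" if "j \<in> {1..d}" for j
  proof -
    note [measurable] = meas[OF that T]
    show ?thesis by measurable
  qed
  have 2: "{\<omega>\<in>space M. X i t \<omega> \<noteq> X j t \<omega>} \<in> sets M" if "i \<in> {1..d}" "j \<in> {1..d}" "t \<in> Q" for i j t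
  proof -
    have "t \<ge> 0" using Q that by auto
    note [measurable] = meas[OF that(1) this] meas[OF that(2) this]
    show ?thesis by measurable
  qed
  have 3: "{\<omega>\<in>space M. \<forall>t\<in>Q. X i t \<omega> \<noteq> X j t \<omega>} \<in> sets M" if "i \<in> {1..d}" "j \<in> {1..d}" for i j
    using 2[OF that] Q by (intro sets.sets_Collect_countable_All') auto
  show ?thesis unfolding eq
    by (intro sets.sets_Collect_conj sets.sets_Collect_finite_All sets.sets_Collect_imp
        sets.sets_Collect_const 1 3) auto
qed

section \<open>Discretisation of the walks\<close>

text \<open>A union bound: per cell there are d events that a walk is not quiet and at most d^2
  events that two given walks both move, each of probability at most h^2. For the pairs this is
  independence of the walks, each of which moves with probability at most h.\<close>

lemma independent_random_walks_quiet:
  assumes X: "independent_random_walks M d x X" and h: "h > 0"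
  obtains B where "B \<in> sets M" "measure M B \<le> real K * ((real d + (real d)\<^sup>2) * h\<^sup>2)"
    "\<And>\<omega> i j. \<omega> \<in> space M - B \<Longrightarrow> i < K \<Longrightarrow> j \<in> {1..d} \<Longrightarrow> quiet_cell h (\<lambda>t. X j t \<omega>) i"
    "\<And>\<omega> i j k. \<omega> \<in> space M - B \<Longrightarrow> i < K \<Longrightarrow> j \<in> {1..d} \<Longrightarrow> k \<in> {1..d} \<Longrightarrow> j \<noteq> k
      \<Longrightarrow> cell_inc h (\<lambda>t. X j t \<omega>) i = 0 \<or> cell_inc h (\<lambda>t. X k t \<omega>) i = 0"
proof -
  interpret prob_space M using X by (simp add: independent_random_walks_def)
  have indep: "indep_vars (\<lambda>_. path_space) (\<lambda>j. sample_path (X j)) {1..d}"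
    and rw: "\<And>j. j \<in> {1..d} \<Longrightarrow> random_walk M (x j) (X j)"
    using X by (auto simp: independent_random_walks_def)
  define good where "good i j B \<longleftrightarrow> B \<in> events \<and> prob B \<le> h\<^sup>2
    \<and> (\<forall>\<omega>\<in>space M - B. quiet_cell h (\<lambda>t. X j t \<omega>) i)" for i j B
  \<comment> \<open>The exceptional events come one cell and one walk at a time; a choice makes them
    a family over which unions can be formed.\<close>
  define S where "S i j = (SOME B. good i j B)" for i j
  have ex: "\<exists>B. good i j B" if j: "j \<in> {1..d}" for i j
  proof (rule random_walk_quiet[OF rw[OF j] h, where i = i])
    fix B assume "B \<in> events" "prob B \<le> h\<^sup>2"
      "\<And>\<omega>. \<omega> \<in> space M - B \<Longrightarrow> quiet_cell h (\<lambda>t. X j t \<omega>) i"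
    then show ?thesis unfolding good_def by (intro exI[of _ B] conjI ballI)
  qed
  have "good i j (S i j)" if "j \<in> {1..d}" for i j
    unfolding S_def by (rule someI_ex[OF ex[OF that]])
  then have S: "S i j \<in> events \<and> prob (S i j) \<le> h\<^sup>2 \<and> (\<forall>\<omega>\<in>space M - S i j. quiet_cell h (\<lambda>t. X j t \<omega>) i)"
    if "j \<in> {1..d}" for i j
    using that unfolding good_def by blast
  define F where "F i j = {\<omega>\<in>space M. cell_inc h (\<lambda>t. X j t \<omega>) i \<noteq> 0}" for i j
  have Fp: "prob (F i j) \<le> h" if "j \<in> {1..d}" for i j
    unfolding F_def by (rule random_walk_quiet[OF rw[OF that] h, where i = i])
  \<comment> \<open>Independence is assumed for whole sample paths, so the event that a walk moves
    in cell i is written as a preimage of a set of paths.\<close>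
  let ?A = "\<lambda>i. {f\<in>space path_space. cell_inc h f i \<in> - {0::int}}"
  have Fs: "sample_path (X j) -` ?A i \<inter> space M = F i j" if "j \<in> {1..d}" for i j
  proof -
    have "sample_path (X j) \<in> measurable M path_space" using indep that by (auto simp: indep_vars_def)
    from measurable_space[OF this] show ?thesis using h by (auto simp: F_def cell_inc_sample_path)
  qed
  have Fe: "F i j \<in> events" if "j \<in> {1..d}" for i j
  proof -
    have "sample_path (X j) \<in> measurable M path_space" using indep that by (auto simp: indep_vars_def)
    from measurable_sets[OF this sets_cell_inc[of h i "- {0}"]] show ?thesis
      using h by (simp only: Fs[OF that])
  qed
  have pair: "prob (F i j \<inter> F i k) \<le> h\<^sup>2" if jk: "j \<in> {1..d}" "k \<in> {1..d}" "j \<noteq> k" for i j k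
  proof -
    have "prob (\<Inter>l\<in>{j, k}. sample_path (X l) -` ?A i \<inter> space M)
        = (\<Prod>l\<in>{j, k}. prob (sample_path (X l) -` ?A i \<inter> space M))"
      using jk h by (intro indep_varsD[OF indep] sets_cell_inc) auto
    also have "(\<Inter>l\<in>{j, k}. sample_path (X l) -` ?A i \<inter> space M) = (\<Inter>l\<in>{j, k}. F i l)"
      by (intro INF_cong refl Fs) (use jk in auto)
    also have "(\<Prod>l\<in>{j, k}. prob (sample_path (X l) -` ?A i \<inter> space M)) = (\<Prod>l\<in>{j, k}. prob (F i l))"
      by (intro prod.cong refl arg_cong[where f = prob] Fs) (use jk in auto)
    finally have "prob (F i j \<inter> F i k) = prob (F i j) * prob (F i k)"
      using jk(3) by simp
    also have "\<dots> \<le> h * h" using Fp jk h by (intro mult_mono) auto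
    finally show ?thesis by (simp add: power2_eq_square)
  qed
  define P where "P = {(j, k). j \<in> {1..d} \<and> k \<in> {1..d} \<and> j \<noteq> k}"
  have P: "finite P" "card P \<le> d\<^sup>2"
  proof -
    have "P \<subseteq> {1..d} \<times> {1..d}" by (auto simp: P_def)
    from finite_subset[OF this] card_mono[OF _ this] show "finite P" "card P \<le> d\<^sup>2"
      by (auto simp: power2_eq_square)
  qed
  define C where "C i = (\<Union>j\<in>{1..d}. S i j) \<union> (\<Union>(j, k)\<in>P. F i j \<inter> F i k)" for i
  have Ce: "C i \<in> events" for i
    unfolding C_def using S Fe P by (intro sets.Un sets.finite_UN) (auto simp: P_def)
  have Cp: "prob (C i) \<le> (real d + (real d)\<^sup>2) * h\<^sup>2" for i
  proof -
    have "prob (\<Union>j\<in>{1..d}. S i j) \<le> (\<Sum>j\<in>{1..d}. prob (S i j))"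
      using S by (intro finite_measure_subadditive_finite) auto
    also have "\<dots> \<le> real (card {1..d}) * h\<^sup>2" using S by (intro sum_bounded_above) auto
    finally have 1: "prob (\<Union>j\<in>{1..d}. S i j) \<le> real d * h\<^sup>2" by simp
    have "prob (\<Union>p\<in>P. case p of (j, k) \<Rightarrow> F i j \<inter> F i k)
        \<le> (\<Sum>p\<in>P. prob (case p of (j, k) \<Rightarrow> F i j \<inter> F i k))"
      using Fe P by (intro finite_measure_subadditive_finite) (auto simp: P_def)
    also have "\<dots> \<le> real (card P) * h\<^sup>2"
      using pair by (intro sum_bounded_above) (auto simp: P_def)
    also have "\<dots> \<le> (real d)\<^sup>2 * h\<^sup>2"
      using P(2) by (intro mult_right_mono) (simp_all flip: of_nat_power)
    finally have 2: "prob (\<Union>(j, k)\<in>P. F i j \<inter> F i k) \<le> (real d)\<^sup>2 * h\<^sup>2" .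
    have "prob (C i) \<le> prob (\<Union>j\<in>{1..d}. S i j) + prob (\<Union>(j, k)\<in>P. F i j \<inter> F i k)"
      unfolding C_def using S Fe P by (intro measure_Un_le sets.finite_UN) (auto simp: P_def)
    then show ?thesis using 1 2 by (simp add: distrib_right)
  qed
  let ?B = "\<Union>i<K. C i"
  have "prob ?B \<le> (\<Sum>i<K. prob (C i))"
    using Ce by (intro finite_measure_subadditive_finite) auto
  also have "\<dots> \<le> real (card {..<K}) * ((real d + (real d)\<^sup>2) * h\<^sup>2)"
    using Cp by (intro sum_bounded_above) auto
  finally have Bp: "prob ?B \<le> real K * ((real d + (real d)\<^sup>2) * h\<^sup>2)" by simp
  have Be: "?B \<in> events" using Ce by auto
  show ?thesis
  proof (rule that[OF Be Bp])
    fix \<omega> i j assume "\<omega> \<in> space M - ?B" "i < K" "j \<in> {1..d}"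
    then show "quiet_cell h (\<lambda>t. X j t \<omega>) i" using S[of j i] by (auto simp: C_def)
  next
    fix \<omega> i j k assume "\<omega> \<in> space M - ?B" "i < K" "j \<in> {1..d}" "k \<in> {1..d}" "j \<noteq> k"
    then have "\<omega> \<notin> F i j \<inter> F i k" by (auto simp: C_def P_def)
    then show "cell_inc h (\<lambda>t. X j t \<omega>) i = 0 \<or> cell_inc h (\<lambda>t. X k t \<omega>) i = 0"
      using \<open>\<omega> \<in> space M - ?B\<close> by (auto simp: F_def)
  qed
qed

text \<open>A single unit step shrinks a gap by at most one. A positive integer gap thus becomes at
  worst 0, which distinctness excludes: walks cannot change order without meeting.\<close>

lemma chamber_nbrs:
  assumes "chamber d z" "z \<in> nbrs d w" "inj_on w {1..d}"
  shows "chamber d w"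
  unfolding chamber_def
proof
  fix j assume j: "j \<in> {1..<d}"
  have "z j < z (Suc j)" using assms(1) j by (auto simp: chamber_def)
  moreover have "z (Suc j) - z j \<le> w (Suc j) - w j + 1"
    using assms(2) by (auto simp: nbrs_def)
  moreover have "w j \<noteq> w (Suc j)" using inj_onD[OF assms(3), of j "Suc j"] j by auto
  ultimately show "w j < w (Suc j)" by linarith
qed

lemma chamber_inj_on: "chamber d z \<Longrightarrow> inj_on z {1..d}"
  by (rule inj_onI) (metis atLeastAtMost_iff chamber_less linorder_neqE_nat order_less_irrefl)

text \<open>With at most one walk moving in a cell, and quietly, the configuration at any time is
  that of one end of its cell. Distinctness at all times is then distinctness at grid times, and
  since each grid step goes to a neighbour, the order present at time 0 is kept.\<close>

lemma nonintersecting_iff_grid_path: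
  fixes X :: "nat \<Rightarrow> real \<Rightarrow> 'a \<Rightarrow> int" and d :: nat and \<omega> :: 'a
  defines "pos \<equiv> \<lambda>t j. if j \<in> {1..d} then X j t \<omega> else 0"
  assumes h: "h > 0" and K: "K \<ge> 1" and start: "chamber d (pos 0)"
    and quiet: "\<And>i j. i < K \<Longrightarrow> j \<in> {1..d} \<Longrightarrow> quiet_cell h (\<lambda>t. X j t \<omega>) i"
    and one: "\<And>i j k. i < K \<Longrightarrow> j \<in> {1..d} \<Longrightarrow> k \<in> {1..d} \<Longrightarrow> j \<noteq> k
      \<Longrightarrow> cell_inc h (\<lambda>t. X j t \<omega>) i = 0 \<or> cell_inc h (\<lambda>t. X k t \<omega>) i = 0"
  shows "((\<forall>j\<in>{1..d}. X j (real K * h) \<omega> = y j) \<and> nonintersecting_on d X (real K * h) \<omega>)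
    \<longleftrightarrow> grid_path d (\<lambda>i. pos (real i * h)) K (\<lambda>j. if j \<in> {1..d} then y j else 0)"
proof -
  let ?p = "\<lambda>i. pos (real i * h)"
  have step: "?p i \<in> nbrs d (?p (Suc i))" "\<And>t. t \<in> {real i * h..real (Suc i) * h} \<Longrightarrow> pos t = ?p i \<or> pos t = ?p (Suc i)"
    if i: "i < K" for i
  proof -
    let ?D = "\<lambda>j. cell_inc h (\<lambda>t. X j t \<omega>) i"
    have D: "?D j = ?p (Suc i) j - ?p i j" if "j \<in> {1..d}" for j
      using that by (simp add: cell_inc_def pos_def)
    have between: "pos t j = ?p i j \<or> pos t j = ?p (Suc i) j"
      if "t \<in> {real i * h..real (Suc i) * h}" for t j
      using quiet[OF i, of j] that by (auto simp: quiet_cell_def pos_def)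
    have "?p i \<in> nbrs d (?p (Suc i))
      \<and> (\<forall>t\<in>{real i * h..real (Suc i) * h}. pos t = ?p i \<or> pos t = ?p (Suc i))"
    proof (cases "\<exists>j\<in>{1..d}. ?D j \<noteq> 0")
      case False
      have "?p i j = ?p (Suc i) j" for j
      proof (cases "j \<in> {1..d}")
        case True
        then have "?D j = 0" using False by blast
        then show ?thesis using D[OF True] by linarith
      next
        case False
        then show ?thesis by (simp only: pos_def if_False)
      qed
      then have eq: "?p i = ?p (Suc i)" by blast
      have "pos t = ?p i" if "t \<in> {real i * h..real (Suc i) * h}" for t
      proof (rule ext)
        show "pos t k = ?p i k" for k
          using between[OF that, of k] unfolding eq by (simp only: disj_absorb)
      qed
      moreover have "?p i \<in> nbrs d (?p (Suc i))"
        unfolding eq nbrs_def by (rule insertI1)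
      ultimately show ?thesis by blast
    next
      case True
      then obtain j where j: "j \<in> {1..d}" "?D j \<noteq> 0" by blast
      have other: "?p i k = ?p (Suc i) k" if "k \<noteq> j" for k
      proof (cases "k \<in> {1..d}")
        case True
        then have "?D k = 0" using one[OF i j(1) True] that j(2) by blast
        then show ?thesis using D[OF True] by linarith
      next
        case False
        then show ?thesis by (simp only: pos_def if_False)
      qed
      have "\<bar>?D j\<bar> \<le> 1" using quiet[OF i j(1)] by (simp add: quiet_cell_def)
      then have "?p i j = ?p (Suc i) j - 1 \<or> ?p i j = ?p (Suc i) j + 1"
        using j D[OF j(1)] by linarith
      then have "?p i = (?p (Suc i))(j := ?p (Suc i) j - 1) \<or> ?p i = (?p (Suc i))(j := ?p (Suc i) j + 1)"
      proof
        assume "?p i j = ?p (Suc i) j - 1"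
        then have "?p i k = ((?p (Suc i))(j := ?p (Suc i) j - 1)) k" for k
          using other[of k] by (cases "k = j") (simp_all only: fun_upd_same fun_upd_other simp_thms)
        then show ?thesis by blast
      next
        assume "?p i j = ?p (Suc i) j + 1"
        then have "?p i k = ((?p (Suc i))(j := ?p (Suc i) j + 1)) k" for k
          using other[of k] by (cases "k = j") (simp_all only: fun_upd_same fun_upd_other simp_thms)
        then show ?thesis by blast
      qed
      then have "?p i \<in> nbrs d (?p (Suc i))" using j(1) unfolding nbrs_def by blast
      moreover have "pos t = ?p i \<or> pos t = ?p (Suc i)" if "t \<in> {real i * h..real (Suc i) * h}" for t
      proof -
        have o: "pos t k = ?p i k \<and> pos t k = ?p (Suc i) k" if "k \<noteq> j" for k
          using between[OF \<open>t \<in> _\<close>, of k] unfolding other[OF that] by (simp only: disj_absorb simp_thms)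
        from between[OF that, of j] show ?thesis
        proof
          assume e: "pos t j = ?p i j"
          have "pos t k = ?p i k" for k using o[of k] e by (cases "k = j") blast+
          then show ?thesis by blast
        next
          assume e: "pos t j = ?p (Suc i) j"
          have "pos t k = ?p (Suc i) k" for k using o[of k] e by (cases "k = j") blast+
          then show ?thesis by blast
        qed
      qed
      ultimately show ?thesis by blast
    qed
    then show "?p i \<in> nbrs d (?p (Suc i))"
      "\<And>t. t \<in> {real i * h..real (Suc i) * h} \<Longrightarrow> pos t = ?p i \<or> pos t = ?p (Suc i)" by auto
  qed
  have final: "(\<forall>j\<in>{1..d}. X j (real K * h) \<omega> = y j) \<longleftrightarrow> ?p K = (\<lambda>j. if j \<in> {1..d} then y j else 0)"
    unfolding pos_def fun_eq_iff by (simp only: Ball_def) metis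
  have non: "nonintersecting_on d X (real K * h) \<omega> \<longleftrightarrow> (\<forall>t\<in>{0..real K * h}. inj_on (pos t) {1..d})"
    unfolding nonintersecting_on_def inj_on_def pos_def by auto
  have "(\<forall>t\<in>{0..real K * h}. inj_on (pos t) {1..d}) \<longleftrightarrow> (\<forall>i\<le>K. chamber d (?p i))"
  proof
    assume inj: "\<forall>t\<in>{0..real K * h}. inj_on (pos t) {1..d}"
    have "i \<le> K \<Longrightarrow> chamber d (?p i)" for i
    proof (induction i)
      case (Suc i)
      have "real (Suc i) * h \<in> {0..real K * h}"
        using Suc.prems h by (simp only: atLeastAtMost_iff) (intro conjI mult_right_mono mult_nonneg_nonneg; simp)
      then have "inj_on (?p (Suc i)) {1..d}" using inj by blast
      moreover have i: "i < K" using Suc.prems by simp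
      moreover have "chamber d (?p i)" by (rule Suc.IH) (rule less_imp_le[OF i])
      ultimately show ?case using chamber_nbrs[OF _ step(1)[OF i]] by blast
    qed (use start in simp)
    then show "\<forall>i\<le>K. chamber d (?p i)" by blast
  next
    assume ch: "\<forall>i\<le>K. chamber d (?p i)"
    show "\<forall>t\<in>{0..real K * h}. inj_on (pos t) {1..d}"
    proof
      fix t assume t: "t \<in> {0..real K * h}"
      have "\<exists>i<K. t \<in> {real i * h..real (Suc i) * h}"
      \<comment> \<open>The cell containing t has the index floor(t/h), except at the right end
        point, where this would be K and the last cell is taken instead.\<close>
      proof (cases "t = real K * h")
        case True
        then show ?thesis using K h by (intro exI[of _ "K - 1"]) (auto intro: mult_right_mono)
      next
        case False
        define i where "i = nat \<lfloor>t / h\<rfloor>"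
        have r: "0 \<le> t / h" "t / h < real K" using t h False by (simp_all add: pos_divide_less_eq)
        then have "real i \<le> t / h" "t / h \<le> real (Suc i)" by (simp_all add: i_def) linarith
        moreover from this r have "i < K" by linarith
        ultimately show ?thesis using h
          by (intro exI[of _ i]) (simp add: pos_le_divide_eq pos_divide_le_eq)
      qed
      then obtain i where i: "i < K" "t \<in> {real i * h..real (Suc i) * h}" by blast
      from step(2)[OF i] show "inj_on (pos t) {1..d}"
      proof
        assume "pos t = ?p i"
        then show ?thesis using chamber_inj_on[of d "?p i"] ch i(1) by simp
      next
        assume "pos t = ?p (Suc i)"
        moreover have "chamber d (?p (Suc i))" using ch i(1) Suc_leI by blast
        ultimately show ?thesis using chamber_inj_on[of d "?p (Suc i)"] by metis
      qed
    qed
  qed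
  moreover have "(\<forall>i\<le>K. chamber d (?p i)) \<longleftrightarrow> (\<forall>i<K. chamber d (?p (Suc i)))"
  proof
    assume c: "\<forall>i<K. chamber d (?p (Suc i))"
    have "chamber d (?p i)" if "i \<le> K" for i
      using c that start by (cases i) auto
    then show "\<forall>i\<le>K. chamber d (?p i)" by blast
  qed (use Suc_leI in blast)
  ultimately show ?thesis unfolding final non grid_path_def using step(1) by blast
qed


section \<open>Refining the grid\<close>

lemma binomial_over_power:
  "real (K choose m) / real K ^ m \<le> 1 / fact m"
  "(\<lambda>K. real (K choose m) / real K ^ m) \<longlonglongrightarrow> 1 / fact m"
proof -
  have "(\<forall>K. real (K choose m) / real K ^ m \<le> 1 / fact m)
    \<and> (\<lambda>K. real (K choose m) / real K ^ m) \<longlonglongrightarrow> 1 / fact m"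
  proof (induction m)
    case (Suc m)
    \<comment> \<open>The quotient of consecutive terms is (1 - m/K) / (m+1). It is at most 1/(m+1)
      and tends to it, which yields the bound and the limit together.\<close>
    have rec: "real (K choose Suc m) / real K ^ Suc m
        = real (K choose m) / real K ^ m * (1 - real m / real K) / real (Suc m)" if "K \<ge> m" "K \<ge> 1" for K
    proof -
      have "Suc m * (K choose Suc m) = (K - m) * (K choose m)"
        using binomial_absorb_comp[of K m] times_binomial_minus1_eq[of "Suc m" K] by simp
      then have "real (Suc m) * real (K choose Suc m) = real (K - m) * real (K choose m)"
        by (metis of_nat_mult)
      then have A: "real (K choose Suc m) = (real K - real m) * real (K choose m) / real (Suc m)"
        using that by (simp add: of_nat_diff eq_divide_eq mult.commute del: of_nat_Suc)
      have "1 - real m / real K = (real K - real m) / real K"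
        using that by (simp add: diff_divide_distrib)
      then show ?thesis unfolding A by (simp add: mult_ac del: of_nat_Suc)
    qed
    have "real (K choose Suc m) / real K ^ Suc m \<le> 1 / fact (Suc m)" for K
    proof (cases "K \<ge> Suc m")
      case True
      have "real (K choose m) / real K ^ m * (1 - real m / real K) \<le> 1 / fact m * 1"
        using Suc True by (intro mult_mono) auto
      then have "real (K choose m) / real K ^ m * (1 - real m / real K) / real (Suc m)
          \<le> 1 / fact m * 1 / real (Suc m)"
        by (intro divide_right_mono) auto
      then show ?thesis using True by (subst rec) (simp_all add: mult.commute)
    qed (simp add: binomial_eq_0)
    moreover have "(\<lambda>K. real (K choose Suc m) / real K ^ Suc m) \<longlonglongrightarrow> 1 / fact (Suc m)"
    proof -
      have "(\<lambda>K. real (K choose m) / real K ^ m * (1 - real m / real K) / real (Suc m))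
          \<longlonglongrightarrow> 1 / fact m * (1 - 0) / real (Suc m)"
        by (intro tendsto_divide[OF tendsto_mult[OF conjunct2[OF Suc]]] tendsto_diff tendsto_const lim_const_over_n) simp
      moreover have "eventually (\<lambda>K. real (K choose m) / real K ^ m * (1 - real m / real K) / real (Suc m)
          = real (K choose Suc m) / real K ^ Suc m) sequentially"
        using eventually_ge_at_top[of "Suc m"] by eventually_elim (subst rec, auto)
      ultimately show ?thesis by (simp add: Lim_transform_eventually mult.commute)
    qed
    ultimately show ?case by blast
  qed simp
  then show "real (K choose m) / real K ^ m \<le> 1 / fact m"
    "(\<lambda>K. real (K choose m) / real K ^ m) \<longlonglongrightarrow> 1 / fact m" by auto
qed

text \<open>Termwise, (K choose m) / K^m tends to 1/m!. Tannery's theorem with the majorant (2dt)^m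
  / m! exchanges limit and sum.\<close>

lemma binomial_walks_limit:
  assumes t: "t \<ge> 0"
  shows "(\<lambda>K. binomial_walks (t / real K) d x K z) \<longlonglongrightarrow> (\<Sum>m. t ^ m / fact m * walks_from d x m z)"
proof -
  let ?a = "\<lambda>m K. real (K choose m) / real K ^ m * (t ^ m * walks_from d x m z)"
  let ?M = "\<lambda>m. (2 * real d * t) ^ m / fact m"
  have lim: "?a m \<longlonglongrightarrow> 1 / fact m * (t ^ m * walks_from d x m z)" for m
    by (intro tendsto_mult binomial_over_power tendsto_const)
  have "norm (?a m K) \<le> ?M m" for m K
  proof -
    have "?a m K \<le> 1 / fact m * (t ^ m * (2 * real d) ^ m)"
      using t walks_from_nonneg[of d x m z] walks_from_le[of d x m z] binomial_over_power(1)[of K m]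
      by (intro mult_mono mult_nonneg_nonneg) auto
    moreover have "0 \<le> ?a m K" using t walks_from_nonneg[of d x m z] by simp
    ultimately show ?thesis by (simp add: power_mult_distrib mult_ac)
  qed
  then have bound: "eventually (\<lambda>(m, K). norm (?a m K) \<le> ?M m) (at_top \<times>\<^sub>F sequentially)"
    by (intro always_eventually) auto
  have "summable ?M" using summable_exp[of "2 * real d * t"] by (simp add: field_simps)
  from tannerys_theorem[OF lim bound this] have
    "(\<lambda>K. \<Sum>m. ?a m K) \<longlonglongrightarrow> (\<Sum>m. 1 / fact m * (t ^ m * walks_from d x m z))"
    by simp
  moreover have "(\<Sum>m. ?a m K) = binomial_walks (t / real K) d x K z" for K
  proof -
    have "(\<Sum>m. ?a m K) = (\<Sum>m\<le>K. ?a m K)"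
      by (intro suminf_finite) (auto simp: binomial_eq_0)
    then show ?thesis by (simp add: binomial_walks_def power_divide mult_ac)
  qed
  ultimately show ?thesis by simp
qed

lemma nonintersection_prob_packed:
  assumes X: "independent_random_walks M d x X" and d: "d \<ge> 1" and T: "T > 0"
    and x: "\<And>j. j \<in> {1..d} \<Longrightarrow> x j = int j"
  shows "nonintersection_prob M d X y T = exp (- (real d * T))
    * (\<Sum>m. (T / 2) ^ m / fact m * walks_from d (packed d) m (\<lambda>j. if j \<in> {1..d} then y j else 0))"
proof -
  interpret prob_space M using X by (simp add: independent_random_walks_def)
  have rw: "\<And>j. j \<in> {1..d} \<Longrightarrow> random_walk M (x j) (X j)"
    using X by (auto simp: independent_random_walks_def)
  let ?y = "\<lambda>j. if j \<in> {1..d} then y j else 0"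
  let ?E = "{\<omega>\<in>space M. (\<forall>j\<in>{1..d}. X j T \<omega> = y j) \<and> nonintersecting_on d X T \<omega>}"
  have E: "?E \<in> events" using nonintersection_event[OF rw] T by simp
  define R where "R K = binomial_walks (T / 2 / real K) d (packed d) K ?y" for K
  \<comment> \<open>K cells with exceptional probability (d + d^2) h^2 each, at h = T/K, add up to
    C/K.\<close>
  define C where "C = (real d + (real d)\<^sup>2) * T\<^sup>2"
  have bounds: "exp (- (real d * T)) * R K - C / real K \<le> prob ?E
      \<and> prob ?E \<le> exp (- (real d * T) + real d * T\<^sup>2 / 4 / real K) * R K + C / real K" if K: "K \<ge> 1" for K
  proof -
    define h where "h = T / real K"
    have h: "h > 0" "real K * h = T" using T K by (auto simp: h_def)
    define pos where "pos t \<omega> = (\<lambda>j. if j \<in> {1..d} then X j t \<omega> else 0)" for t \<omega>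
    define q where "q = skellam_mass (h / 2)"
    have start: "pos 0 \<omega> = packed d" if "\<omega> \<in> space M" for \<omega>
      using random_walk_start[OF rw that] x by (auto simp: pos_def packed_def fun_eq_iff)
    let ?G = "{\<omega>\<in>space M. grid_path d (\<lambda>i. pos (real i * h) \<omega>) K ?y}"
    have inc: "prob {\<omega>\<in>space M. \<forall>i<K. \<forall>j\<in>{1..d}. pos (real (Suc i) * h) \<omega> j - pos (real i * h) \<omega> j = s i j}
      = (\<Prod>i<K. step_weight q d (s i))" for s
    proof -
      have "{\<omega>\<in>space M. \<forall>i<K. \<forall>j\<in>{1..d}. pos (real (Suc i) * h) \<omega> j - pos (real i * h) \<omega> j = s i j}
        = {\<omega>\<in>space M. \<forall>i<K. \<forall>j\<in>{1..d}. cell_inc h (\<lambda>t. X j t \<omega>) i = s i j}"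
        by (intro Collect_cong conj_cong refl all_cong ball_cong) (simp add: pos_def cell_inc_def)
      then show ?thesis using independent_random_walks_cell_incs[OF X h(1) d, of K s] by (simp only: q_def)
    qed
    have meas: "(\<lambda>\<omega>. pos (real i * h) \<omega> j) \<in> measurable M (count_space UNIV)" if "j \<in> {1..d}" for i j
      using random_walk_measurable[OF rw[OF that], of "real i * h"] h(1) that by (simp add: pos_def)
    have G: "?G \<in> events" "prob ?G = path_weight q d (packed d) K ?y"
    proof -
      have out: "pos (real i * h) \<omega> j = packed d j" if "j \<notin> {1..d}" for i j \<omega>
        unfolding pos_def packed_def using that by (simp only: if_False)
      have start': "pos (real 0 * h) \<omega> = packed d" if "\<omega> \<in> space M" for \<omega>
        using start[OF that] by simp
      show "?G \<in> events"
        by (rule prob_grid_path(1)[where pos = "\<lambda>i. pos (real i * h)" and x = "packed d" and q = q])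
          (erule start' | erule out | erule meas | rule inc)+
      show "prob ?G = path_weight q d (packed d) K ?y"
        by (rule prob_grid_path(2)[where pos = "\<lambda>i. pos (real i * h)" and x = "packed d" and q = q])
          (erule start' | erule out | erule meas | rule inc)+
    qed
    obtain B where B: "B \<in> events" "prob B \<le> real K * ((real d + (real d)\<^sup>2) * h\<^sup>2)"
      and quiet: "\<And>\<omega> i j. \<omega> \<in> space M - B \<Longrightarrow> i < K \<Longrightarrow> j \<in> {1..d} \<Longrightarrow> quiet_cell h (\<lambda>t. X j t \<omega>) i"
      and one: "\<And>\<omega> i j k. \<omega> \<in> space M - B \<Longrightarrow> i < K \<Longrightarrow> j \<in> {1..d} \<Longrightarrow> k \<in> {1..d} \<Longrightarrow> j \<noteq> k
        \<Longrightarrow> cell_inc h (\<lambda>t. X j t \<omega>) i = 0 \<or> cell_inc h (\<lambda>t. X k t \<omega>) i = 0"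
      by (rule independent_random_walks_quiet[OF X h(1), of K]) blast
    have PB: "prob B \<le> C / real K"
      using B(2) K by (simp add: C_def h_def power_divide power2_eq_square)
    have "\<omega> \<in> ?E \<longleftrightarrow> \<omega> \<in> ?G" if \<omega>: "\<omega> \<in> space M - B" for \<omega>
    proof -
      have "chamber d (pos 0 \<omega>)" using start \<omega> chamber_packed by simp
      with nonintersecting_iff_grid_path[where X = X and d = d and \<omega> = \<omega> and h = h and K = K and y = y, OF h(1) K]
        quiet[OF \<omega>] one[OF \<omega>]
      show ?thesis using \<omega> by (simp add: h(2) pos_def)
    qed
    then have sub: "?E \<subseteq> ?G \<union> B" "?G \<subseteq> ?E \<union> B" by blast+
    have "prob ?E \<le> prob (?G \<union> B)" "prob ?G \<le> prob (?E \<union> B)"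
      by (rule finite_measure_mono[OF sub(1) sets.Un[OF G(1) B(1)]]
          finite_measure_mono[OF sub(2) sets.Un[OF E B(1)]])+
    moreover have "prob (?G \<union> B) \<le> prob ?G + prob B" "prob (?E \<union> B) \<le> prob ?E + prob B"
      by (rule measure_Un_le[OF G(1) B(1)] measure_Un_le[OF E B(1)])+
    ultimately have close: "prob ?G - C / real K \<le> prob ?E" "prob ?E \<le> prob ?G + C / real K"
      using PB by linarith+
    have h2: "h / 2 \<ge> 0" using h by simp
    have "exp (- h) \<le> q 0" "q 0 \<le> exp (- h) * exp ((h / 2)\<^sup>2)"
      "\<And>s. s \<in> {1, -1} \<Longrightarrow> exp (- h) * (h / 2) \<le> q s \<and> q s \<le> exp (- h) * (h / 2) * exp ((h / 2)\<^sup>2)"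
      using skellam_mass_0_bounds[OF h2] skellam_mass_1_bounds[OF h2] by (auto simp: q_def)
    note w = path_weight_bounds[where q = q and e = "exp (- h)" and b = "exp ((h / 2)\<^sup>2)"
        and u = "h / 2" and k = K and z = ?y, OF this _ _ h2 chamber_packed[of d]]
    have "(exp (- h) ^ d) ^ K = exp (- (real d * T))"
      unfolding h(2)[symmetric] by (simp add: mult_ac flip: exp_of_nat_mult)
    \<comment> \<open>The surplus over the lower bound is exp(h^2/4) for each of d walks and K
      cells, that is exp(d T^2 / (4K)), and it disappears as K grows.\<close>
    moreover have "((exp (- h) * exp ((h / 2)\<^sup>2)) ^ d) ^ K = exp (- (real d * T) + real d * T\<^sup>2 / 4 / real K)"
    proof -
      have "((exp (- h) * exp ((h / 2)\<^sup>2)) ^ d) ^ K = exp (real K * (real d * (- h + (h / 2)\<^sup>2)))"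
        by (simp flip: exp_of_nat_mult exp_add)
      also have "real K * (real d * (- h + (h / 2)\<^sup>2)) = - (real d * T) + real d * T\<^sup>2 / 4 / real K"
        using K by (simp add: h_def field_simps power2_eq_square)
      finally show ?thesis .
    qed
    moreover have "binomial_walks (h / 2) d (packed d) K ?y = R K"
      by (simp add: R_def h_def mult.commute)
    ultimately have "exp (- (real d * T)) * R K \<le> prob ?G"
      "prob ?G \<le> exp (- (real d * T) + real d * T\<^sup>2 / 4 / real K) * R K"
      using w unfolding G(2) by simp_all
    then show ?thesis using close by linarith
  qed
  let ?S = "\<Sum>m. (T / 2) ^ m / fact m * walks_from d (packed d) m ?y"
  have R: "R \<longlonglongrightarrow> ?S"
    unfolding R_def using T by (intro binomial_walks_limit) simp
  have l: "(\<lambda>K. exp (- (real d * T)) * R K - C / real K) \<longlonglongrightarrow> exp (- (real d * T)) * ?S - 0"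
    by (intro tendsto_intros R lim_const_over_n)
  have u: "(\<lambda>K. exp (- (real d * T) + real d * T\<^sup>2 / 4 / real K) * R K + C / real K)
      \<longlonglongrightarrow> exp (- (real d * T) + 0) * ?S + 0"
    by (intro tendsto_intros R lim_const_over_n)
  have "eventually (\<lambda>K. exp (- (real d * T)) * R K - C / real K \<le> prob ?E) sequentially"
    "eventually (\<lambda>K. prob ?E \<le> exp (- (real d * T) + real d * T\<^sup>2 / 4 / real K) * R K + C / real K) sequentially"
    using bounds by (auto simp: eventually_at_top_linorder intro!: exI[of _ 1])
  from tendsto_sandwich[OF this l[unfolded diff_0_right] u[unfolded add_0_right]]
  have "(\<lambda>K. prob ?E) \<longlonglongrightarrow> exp (- (real d * T)) * ?S" .
  then show ?thesis by (simp add: nonintersection_prob_def LIMSEQ_const_iff)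
qed

section \<open>The asymptotics\<close>

text \<open>For l \<ge> L the factor exp(c (l - L)) is at least 1 and may be inserted; the enlarged
  series sums to an exponential. The bound depends on s only through B, hence is uniform, and c is
  free.\<close>

lemma exp_tail_bound:
  fixes B c :: real
  assumes "0 \<le> s" "s \<le> B" "c \<ge> 0"
  shows "(\<Sum>l. if L \<le> l then s ^ l / fact l else 0) \<le> exp (- c * real L) * exp (B * exp c)"
proof -
  have sums: "(\<lambda>l. exp (- c * real L) * ((B * exp c) ^ l /\<^sub>R fact l)) sums (exp (- c * real L) * exp (B * exp c))"
    by (intro sums_mult exp_converges)
  have le: "(if L \<le> l then s ^ l / fact l else 0) \<le> exp (- c * real L) * ((B * exp c) ^ l /\<^sub>R fact l)" for l
  proof (cases "L \<le> l")
    case True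
    have "s ^ l \<le> B ^ l" using assms by (intro power_mono) auto
    also have "\<dots> \<le> B ^ l * exp (c * (real l - real L))"
      using assms True mult_left_mono[of 1 "exp (c * (real l - real L))" "B ^ l"] by simp
    also have "\<dots> = exp (- c * real L) * (B * exp c) ^ l"
      by (simp add: power_mult_distrib exp_diff exp_minus right_diff_distrib field_simps flip: exp_of_nat_mult)
    finally show ?thesis using True by (simp add: divide_right_mono field_simps)
  qed (use assms in auto)
  have "summable (\<lambda>l. if L \<le> l then s ^ l / fact l else 0)"
    using le assms by (intro summable_comparison_test'[OF sums_summable[OF sums]]) auto
  then show ?thesis using suminf_le[OF le _ sums_summable[OF sums]] sums_unique[OF sums] by simp
qed

lemma walk_series_estimate:
  fixes t :: real and d k :: nat
  assumes t: "t > 0" and d: "d \<ge> 1"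
  defines "S \<equiv> \<Sum>m. t ^ m / fact m * walks_from d (packed d) m ((packed d)(d := int d + int k))"
  shows "\<bar>S * fact k / (t ^ k * exp (t\<^sup>2)) - 1\<bar>
    \<le> (\<Sum>l. if Suc d - k \<le> l then (t\<^sup>2) ^ l / fact l else 0)"
proof -
  let ?y = "(packed d)(d := int d + int k)"
  let ?w = "\<lambda>m. walks_from d (packed d) m ?y"
  let ?g = "\<lambda>l. 2 * l + k"
  \<comment> \<open>The true number of walks relative to (2l+k)!/(l! k!). It lies between 0 and 1
    and equals 1 as long as l + k \<le> d, so only later terms can contribute to the error.\<close>
  define r where "r l = ?w (?g l) * (fact l * fact k) / fact (?g l)" for l
  note w = walks_from_packed_last[OF d, of _ k]
  have r: "0 \<le> r l" "r l \<le> 1" "l + k \<le> d \<Longrightarrow> r l = 1" for l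
    using w(2)[of l] w(3)[of l] walks_from_nonneg[of d "packed d" "?g l" ?y]
    by (auto simp: r_def field_simps)
  have e: "(\<lambda>l. (t\<^sup>2) ^ l /\<^sub>R fact l) sums exp (t\<^sup>2)" by (rule exp_converges)
  then have e': "(\<lambda>l. (t\<^sup>2) ^ l / fact l) sums exp (t\<^sup>2)" by (simp add: field_simps)
  have sr: "summable (\<lambda>l. r l * ((t\<^sup>2) ^ l / fact l))"
  proof (rule summable_comparison_test'[OF sums_summable[OF e']])
    show "norm (r l * ((t\<^sup>2) ^ l / fact l)) \<le> (t\<^sup>2) ^ l / fact l" for l
      using r(1,2)[of l] by (simp add: abs_mult mult_left_le_one_le divide_right_mono)
  qed
  have trm: "t ^ ?g l / fact (?g l) * ?w (?g l) = t ^ k / fact k * (r l * ((t\<^sup>2) ^ l / fact l))" for l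
  proof -
    have "t ^ ?g l = t ^ k * (t\<^sup>2) ^ l" by (simp add: power_add power_mult)
    then show ?thesis unfolding r_def by simp
  qed
  have "S = (\<Sum>l. t ^ ?g l / fact (?g l) * ?w (?g l))"
    unfolding S_def
    by (rule suminf_mono_reindex[symmetric]) (use w(1) in \<open>auto simp: strict_mono_def\<close>)
  also have "\<dots> = t ^ k / fact k * (\<Sum>l. r l * ((t\<^sup>2) ^ l / fact l))"
    unfolding trm by (rule suminf_mult[OF sr])
  finally have S: "S * fact k / (t ^ k * exp (t\<^sup>2)) = (\<Sum>l. r l * ((t\<^sup>2) ^ l / fact l)) / exp (t\<^sup>2)"
    using t by simp
  \<comment> \<open>Below \<open>Suc d - k\<close> one has l + k \<le> d. If k > d, the truncated
    subtraction gives 0 and the tail is the whole series.\<close>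
  let ?T = "\<lambda>l. if Suc d - k \<le> l then (t\<^sup>2) ^ l / fact l else 0"
  have T: "summable ?T"
    by (rule summable_comparison_test'[OF sums_summable[OF e']]) auto
  let ?D = "\<lambda>l. (1 - r l) * ((t\<^sup>2) ^ l / fact l)"
  have D: "?D sums (exp (t\<^sup>2) - (\<Sum>l. r l * ((t\<^sup>2) ^ l / fact l)))"
    using sums_diff[OF e' summable_sums[OF sr]] unfolding left_diff_distrib mult_1 .
  have "(\<Sum>l. ?D l) \<le> (\<Sum>l. ?T l)"
  proof (intro suminf_le sums_summable[OF D] T)
    fix l show "?D l \<le> ?T l"
    proof (cases "Suc d - k \<le> l")
      case True
      then show ?thesis using r(1)[of l] mult_right_mono[of "1 - r l" 1 "(t\<^sup>2) ^ l / fact l"] by simp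
    next
      case False
      then show ?thesis using r(3)[of l] by simp
    qed
  qed
  moreover have "0 \<le> (\<Sum>l. ?D l)"
    using r(2) by (intro suminf_nonneg sums_summable[OF D]) simp
  ultimately have b: "0 \<le> exp (t\<^sup>2) - (\<Sum>l. r l * ((t\<^sup>2) ^ l / fact l))"
    "exp (t\<^sup>2) - (\<Sum>l. r l * ((t\<^sup>2) ^ l / fact l)) \<le> (\<Sum>l. ?T l)"
    using sums_unique[OF D] by auto
  have "\<bar>S * fact k / (t ^ k * exp (t\<^sup>2)) - 1\<bar> = (exp (t\<^sup>2) - (\<Sum>l. r l * ((t\<^sup>2) ^ l / fact l))) / exp (t\<^sup>2)"
    unfolding S using b(1) by (simp add: field_simps)
  also have "\<dots> \<le> (exp (t\<^sup>2) - (\<Sum>l. r l * ((t\<^sup>2) ^ l / fact l))) / 1"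
    using b(1) by (intro divide_left_mono) auto
  finally show ?thesis using b(2) by simp
qed

text \<open>\<open>T\<close> and \<open>\<beta>\<^sub>1\<close> are sequences in O(1), so that both
  may vary with n; each n has its own probability space.\<close>

theorem theorem7p2:
  fixes M :: "nat \<Rightarrow> 'a measure"
    and X :: "nat \<Rightarrow> nat \<Rightarrow> real \<Rightarrow> 'a \<Rightarrow> int"
    and x y :: "nat \<Rightarrow> nat \<Rightarrow> int"
    and T :: "nat \<Rightarrow> real"
    and \<beta>\<^sub>1 :: "nat \<Rightarrow> nat"
    and c :: real
  assumes walks: "\<And>n. n \<ge> 1 \<Longrightarrow> independent_random_walks (M n) (n + 1) (x n) (X n)"
    and x: "\<And>n j. n \<ge> 1 \<Longrightarrow> 1 \<le> j \<Longrightarrow> j \<le> n + 1 \<Longrightarrow> x n j = int j"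
    and y: "\<And>n k. n \<ge> 1 \<Longrightarrow> 1 \<le> k \<Longrightarrow> k \<le> n \<Longrightarrow> y n k = int k"
    and y_last: "\<And>n. n \<ge> 1 \<Longrightarrow> y n (n + 1) > int n"
    and T_pos: "\<And>n. n \<ge> 1 \<Longrightarrow> T n > 0"
    and \<beta>\<^sub>1: "\<And>n. n \<ge> 1 \<Longrightarrow> int (\<beta>\<^sub>1 n) = y n (n + 1) - int n"
    and T_bounded: "T \<in> O(\<lambda>_. 1)"
    and \<beta>\<^sub>1_bounded: "(\<lambda>n. real (\<beta>\<^sub>1 n)) \<in> O(\<lambda>_. 1)"
    and c: "c > 0"
  shows "\<exists>E :: nat \<Rightarrow> real. E \<in> O(\<lambda>n. exp (- c * real n)) \<and>
    (\<forall>n\<ge>1. nonintersection_prob (M n) (n + 1) (X n) (y n) (T n) =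
       exp (- (real n + 1) * T n) * (T n / 2) ^ (\<beta>\<^sub>1 n - 1) * exp ((T n)\<^sup>2 / 4)
         / fact (\<beta>\<^sub>1 n - 1) * (1 + E n))"
proof -
  \<comment> \<open>Here d = n + 1, t = T/2 and k = \<open>\<beta>\<^sub>1 n - 1\<close>: the last
    end point n + \<open>\<beta>\<^sub>1 n\<close> lies k above the packed position n + 1.\<close>
  define S where "S n = (\<Sum>m. (T n / 2) ^ m / fact m * walks_from (n + 1) (packed (n + 1)) m
    ((packed (n + 1))(n + 1 := int (n + 1) + int (\<beta>\<^sub>1 n - 1))))" for n
  \<comment> \<open>The claimed identity solved for the relative error; it then holds exactly, and
    only the size of \<open>E\<close> remains to be estimated.\<close>
  define E where "E n = S n * fact (\<beta>\<^sub>1 n - 1) / ((T n / 2) ^ (\<beta>\<^sub>1 n - 1) * exp ((T n / 2)\<^sup>2)) - 1" for n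
  have prob: "nonintersection_prob (M n) (n + 1) (X n) (y n) (T n) = exp (- (real n + 1) * T n) * S n"
    if n: "n \<ge> 1" for n
  proof -
    have "int (\<beta>\<^sub>1 n) > 0" using y_last[OF n] \<beta>\<^sub>1[OF n] by linarith
    then have "y n (n + 1) = int (n + 1) + int (\<beta>\<^sub>1 n - 1)" using \<beta>\<^sub>1[OF n] by (simp add: of_nat_diff)
    then have "(\<lambda>j. if j \<in> {1..n + 1} then y n j else 0)
      = (packed (n + 1))(n + 1 := int (n + 1) + int (\<beta>\<^sub>1 n - 1))"
      using y[OF n] by (auto simp: packed_def fun_eq_iff le_Suc_eq)
    moreover have "nonintersection_prob (M n) (n + 1) (X n) (y n) (T n) = exp (- (real (n + 1) * T n))
      * (\<Sum>m. (T n / 2) ^ m / fact m * walks_from (n + 1) (packed (n + 1)) m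
        (\<lambda>j. if j \<in> {1..n + 1} then y n j else 0))"
      using x[OF n] by (intro nonintersection_prob_packed[OF walks[OF n] _ T_pos[OF n]]) auto
    ultimately show ?thesis by (simp add: S_def algebra_simps)
  qed
  have "nonintersection_prob (M n) (n + 1) (X n) (y n) (T n) =
       exp (- (real n + 1) * T n) * (T n / 2) ^ (\<beta>\<^sub>1 n - 1) * exp ((T n)\<^sup>2 / 4)
         / fact (\<beta>\<^sub>1 n - 1) * (1 + E n)" if n: "n \<ge> 1" for n
  proof -
    have "S n = (T n / 2) ^ (\<beta>\<^sub>1 n - 1) * exp ((T n)\<^sup>2 / 4) / fact (\<beta>\<^sub>1 n - 1) * (1 + E n)"
      using T_pos[OF n] by (simp add: E_def power_divide)
    then show ?thesis unfolding prob[OF n] by simp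
  qed
  moreover have "E \<in> O(\<lambda>n. exp (- c * real n))"
  proof -
    obtain B where B: "eventually (\<lambda>n. \<bar>T n\<bar> \<le> B) sequentially"
      using landau_o.bigE[OF T_bounded] by auto
    obtain b where b: "eventually (\<lambda>n. real (\<beta>\<^sub>1 n) \<le> b) sequentially"
      using landau_o.bigE[OF \<beta>\<^sub>1_bounded] by auto
    \<comment> \<open>The tail starts at an index no smaller than n - b, and shifting it to n costs
      exp(c b). The other factor is the enlarged series at the bound B^2/4 for (T/2)^2.\<close>
    let ?C = "exp (c * b) * exp (B\<^sup>2 / 4 * exp c)"
    have "eventually (\<lambda>n. norm (E n) \<le> ?C * norm (exp (- c * real n))) sequentially"
      using B b eventually_ge_at_top[of 1]
    proof eventually_elim
      case (elim n)
      let ?k = "\<beta>\<^sub>1 n - 1" and ?s = "(T n / 2)\<^sup>2"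
      let ?L = "Suc (n + 1) - ?k"
      have s: "0 \<le> ?s" "?s \<le> B\<^sup>2 / 4"
        using power_mono[OF elim(1), of 2] by (simp_all add: power_divide)
      have "\<bar>E n\<bar> \<le> (\<Sum>l. if ?L \<le> l then ?s ^ l / fact l else 0)"
        unfolding E_def S_def using T_pos[of n] elim by (intro walk_series_estimate) auto
      also have "\<dots> \<le> exp (- c * real ?L) * exp (B\<^sup>2 / 4 * exp c)"
        using c by (intro exp_tail_bound s) auto
      also have "\<dots> \<le> exp (c * b + - c * real n) * exp (B\<^sup>2 / 4 * exp c)"
      proof -
        \<comment> \<open>Truncated subtraction can only enlarge \<open>?L\<close>, so the bound
          also holds when \<open>\<beta>\<^sub>1 n\<close> exceeds n.\<close>
        have "real n - b \<le> real ?L" using elim by linarith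
        then have "c * (real n - b) \<le> c * real ?L" using c by (intro mult_left_mono) auto
        then show ?thesis by (simp add: algebra_simps)
      qed
      finally show ?case by (simp only: exp_add real_norm_def abs_exp_cancel mult_ac)
    qed
    then show ?thesis by (rule bigoI)
  qed
  ultimately show ?thesis by blast
qed

end
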